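(* For every fixed integer $l\ge 3$ and every $\delta>0$ there is a constant $c=c(\delta,l)>0$ such that for every positive integer $n$ and every $p\in[0,1]$, $$\mathbb{P}\big(\xi'_l>(1+\delta)\,n^lp^l\big)<\exp\!\big[-c\,\min\{n^2p^2\ln(1/p),\;n^lp^l\}\big],$$ where $\xi'_l$ is the number of copies of $C_l$ in the random $l$-partite graph $\mathbb{H}$ (with parameters $l,n,p$).
   Context: The random $l$-partite graph $\mathbb{H}$ with parameters $l,n,p$ has vertex set $V=V_1\cup\cdots\cup V_l$, a disjoint union of $l$ sets each of size $n$. For each $i$ (indices mod $l$), each pair $xy$ with $x\in V_i$, $y\in V_{i+1}$ is an edge with probability $p$, all these choices being independent; there are no other edges. A copy of $C_l$ in $\mathbb{H}$ is a subgraph isomorphic to the $l$-cycle having vertices $v_1,\dots,v_l$ with $v_i\in V_i$ for every $i$ (so exactly one vertex in each $V_i$, with $v_i$ adjacent to $v_{i+1}$ for all $i$ mod $l$). At $p=0$ the expression $p^2\ln(1/p)$ is interpreted as $0$. *)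

theory Defs
  imports "HOL-Probability.Probability"
begin

text \<open>A graph is a pair of its vertex set and its set of edges, an edge being
  a set of two vertices.\<close>

type_synonym 'a graph = "'a set \<times> 'a set set"

definition verts :: "'a graph \<Rightarrow> 'a set" where
  "verts G = fst G"

definition edges :: "'a graph \<Rightarrow> 'a set set" where
  "edges G = snd G"

definition is_subgraph :: "'a graph \<Rightarrow> 'a graph \<Rightarrow> bool" where
  "is_subgraph C G \<longleftrightarrow>
     verts C \<subseteq> verts G \<and> edges C \<subseteq> edges G \<and> (\<forall>e \<in> edges C. e \<subseteq> verts C)"

definition graph_isomorphic :: "'a graph \<Rightarrow> 'b graph \<Rightarrow> bool" where
  "graph_isomorphic G G' \<longleftrightarrow>
     (\<exists>\<phi>. bij_betw \<phi> (verts G) (verts G') \<and>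
          (\<forall>x \<in> verts G. \<forall>y \<in> verts G. {x, y} \<in> edges G \<longleftrightarrow> {\<phi> x, \<phi> y} \<in> edges G'))"

definition cycle_graph :: "nat \<Rightarrow> nat graph" where
  "cycle_graph l = ({..<l}, (\<lambda>i. {i, Suc i mod l}) ` {..<l})"

text \<open>The classes are indexed by $0, \dots, l-1$ instead of $1, \dots, l$.\<close>

definition part :: "nat \<Rightarrow> nat \<Rightarrow> (nat \<times> nat) set" where
  "part n i = {i} \<times> {..<n}"

definition partite_verts :: "nat \<Rightarrow> nat \<Rightarrow> (nat \<times> nat) set" where
  "partite_verts l n = (\<Union>i<l. part n i)"

text \<open>For $l \ge 3$ the $l n^2$ pairs below are pairwise distinct as unordered pairs.\<close>

definition potential_edges :: "nat \<Rightarrow> nat \<Rightarrow> (nat \<times> nat) set set" where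
  "potential_edges l n = {{x, y} | x y. \<exists>i<l. x \<in> part n i \<and> y \<in> part n (Suc i mod l)}"

definition random_partite_graph :: "nat \<Rightarrow> nat \<Rightarrow> real \<Rightarrow> (nat \<times> nat) graph pmf" where
  "random_partite_graph l n p =
     map_pmf (\<lambda>f. (partite_verts l n, {e \<in> potential_edges l n. f e}))
       (Pi_pmf (potential_edges l n) False (\<lambda>_. bernoulli_pmf p))"

definition cycle_copies :: "nat \<Rightarrow> nat \<Rightarrow> (nat \<times> nat) graph \<Rightarrow> (nat \<times> nat) graph set" where
  "cycle_copies l n H =
     {C. is_subgraph C H \<and> graph_isomorphic C (cycle_graph l) \<and>
         (\<exists>v. verts C = v ` {..<l} \<and>
              (\<forall>i<l. v i \<in> part n i \<and> {v i, v (Suc i mod l)} \<in> edges C))}"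

end

theory Submission
  imports Defs
begin

text \<open>The proof follows the high-moment method of Harel, Mousset and Samotij.  Let \<open>F U\<close> be the
  expected number of cycles given that all edges of \<open>U\<close> are present, \<open>\<mu> = (n p)^l\<close> and
  \<open>L = ln (1/p)\<close>.  If no set \<open>U\<close> of at most \<open>l k\<close> edges with \<open>F U > (1 + \<delta>/2) \<mu>\<close> is present,
  then the truncated \<open>k\<close>-th moment is at most \<open>((1 + \<delta>/2) \<mu>)^k\<close>, and Markov's inequality gives a
  bound exponentially small in \<open>k\<close>, a small multiple of the minimum in the theorem.  Otherwise a
  core is present: an edge set \<open>K\<close> with \<open>F K \<ge> (1 + \<delta>/4) \<mu>\<close> in which every single edge accounts for
  a fair share of \<open>F K\<close>.

  As \<open>F K\<close> is the trace of a product of \<open>l\<close> matrices, the Hilbert-Schmidt norm shows that a core has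
  at least a constant times \<open>(n p)^2\<close> edges.  The same norm bounds the share of an edge and shows
  that it has an endpoint of degree almost \<open>n\<close> or that its endpoints have degree product almost
  \<open>(n p)^2\<close>.  Given the degrees, each edge therefore has few possible positions, up to powers of \<open>L\<close>,
  and there are few degree sequences, because a core has few vertices.  So the cores with \<open>s\<close> edges
  contribute at most \<open>p^(\<gamma> s)\<close> to the union bound, for a constant \<open>\<gamma> > 0\<close>.\<close>

section \<open>Truncated moments and cores\<close>

text \<open>The difficulty is the union bound over cores. A core with \<open>s\<close> edges has
  probability \<open>p^s\<close>, but naming \<open>s\<close> vertices freely costs about
  \<open>n^s\<close>, and \<open>n p >= 1\<close>. So the vertices whose degrees are recorded must
  cost less than \<open>n\<close> each, or be fewer than \<open>s\<close> by a constant factor. For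
  large \<open>p\<close> a core is so big that naming a vertex costs only about
  \<open>p^(-1/2)\<close>. Below that, the recorded vertices of small degree form an independent set
  or, when degree products carry no information, a core has many branch vertices. All other losses
  are powers of \<open>L\<close>, absorbed by a small power of \<open>1/p\<close> once
  \<open>L\<close> is large; for bounded \<open>L\<close> a core would need more edges than the
  moment method lets it have, so none exists.

  The two terms of the minimum limit \<open>k\<close> for different reasons: \<open>k\<close> below
  a multiple of \<open>(n p)^l\<close> keeps the share of an edge above an absolute constant, and
  \<open>k\<close> below a multiple of \<open>(n p)^2 L\<close> keeps the number of edges within a
  factor \<open>L\<close> of the squared Hilbert-Schmidt norm of the constant matrix
  \<open>p\<close>.\<close>

lemma truncated_moment_le:
  fixes D :: "'e set pmf" and S :: "'c \<Rightarrow> 'e set"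
  assumes fin: "finite E" and supp: "set_pmf D \<subseteq> Pow E"
    and prob: "\<And>U. U \<subseteq> E \<Longrightarrow> measure_pmf.prob D {G. U \<subseteq> G} = p ^ card U"
    and A: "finite A" "\<And>c. c \<in> A \<Longrightarrow> S c \<subseteq> E" "\<And>c. c \<in> A \<Longrightarrow> card (S c) \<le> l"
    and b: "0 \<le> b" and p: "0 \<le> p"
    and core: "\<And>U. U \<subseteq> E \<Longrightarrow> card U + l \<le> m \<Longrightarrow> (\<And>K. K \<in> KK \<Longrightarrow> \<not> K \<subseteq> U) \<Longrightarrow>
                 (\<Sum>c\<in>A. p ^ card (S c - U)) \<le> b"
    and U: "U \<subseteq> E" "card U + l * j \<le> m"
  shows "measure_pmf.expectation D
           (\<lambda>G. real (card {c \<in> A. S c \<subseteq> G}) ^ j * indicator {G. U \<subseteq> G \<and> (\<forall>K\<in>KK. \<not> K \<subseteq> G)} G)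
         \<le> p ^ card U * b ^ j"
  using U
proof (induction j arbitrary: U)
  case 0
  have "measure_pmf.expectation D (indicator {G. U \<subseteq> G \<and> (\<forall>K\<in>KK. \<not> K \<subseteq> G)})
      = measure_pmf.prob D {G. U \<subseteq> G \<and> (\<forall>K\<in>KK. \<not> K \<subseteq> G)}"
    by simp
  also have "\<dots> \<le> measure_pmf.prob D {G. U \<subseteq> G}"
    by (rule measure_pmf.finite_measure_mono) auto
  finally show ?case using 0 prob by simp
next
  have finD: "finite (set_pmf D)"
    using supp fin by (meson finite_Pow_iff finite_subset)
  have int: "integrable (measure_pmf D) f" for f :: "'e set \<Rightarrow> real"
    using finD by (rule integrable_measure_pmf_finite)
  define X where "X G = real (card {c \<in> A. S c \<subseteq> G})" for G
  define I where "I U G = (indicator {G. U \<subseteq> G \<and> (\<forall>K\<in>KK. \<not> K \<subseteq> G)} G :: real)" for U G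
  case (Suc j)
  show ?case
  \<comment> \<open>If \<open>U\<close> contains a core, the truncation makes the integrand vanish;
    so \<open>core\<close> is only needed for core-free \<open>U\<close>.\<close>
  proof (cases "\<exists>K\<in>KK. K \<subseteq> U")
    case True
    then have "I U G = 0" for G by (auto simp: I_def indicator_def)
    then show ?thesis using b p by (simp add: I_def)
  next
    case False
    have X: "X G = (\<Sum>c\<in>A. if S c \<subseteq> G then 1 else 0)" for G
      using A(1) by (simp add: X_def sum.If_cases Collect_conj_eq)
    \<comment> \<open>One factor \<open>X\<close> is expanded over \<open>c\<close>, and
      \<open>I U\<close> times the indicator of \<open>S c \<subseteq> G\<close> is
      \<open>I (U \<union> S c)\<close>. Hence \<open>U\<close> must vary in the induction, and each
      step spends at most \<open>l\<close> of the budget \<open>m\<close>.\<close>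
    have "X G ^ Suc j * I U G = (\<Sum>c\<in>A. X G ^ j * I (U \<union> S c) G)" for G
    proof -
      have "X G ^ Suc j * I U G = X G ^ j * ((\<Sum>c\<in>A. if S c \<subseteq> G then 1 else 0) * I U G)"
        by (simp add: X[symmetric])
      also have "(\<Sum>c\<in>A. if S c \<subseteq> G then 1 else 0) * I U G = (\<Sum>c\<in>A. I (U \<union> S c) G)"
        unfolding sum_distrib_right by (rule sum.cong) (auto simp: I_def indicator_def)
      finally show ?thesis by (simp add: sum_distrib_left)
    qed
    then have "measure_pmf.expectation D (\<lambda>G. X G ^ Suc j * I U G)
        = (\<Sum>c\<in>A. measure_pmf.expectation D (\<lambda>G. X G ^ j * I (U \<union> S c) G))"
      using int by (simp add: Bochner_Integration.integral_sum)
    also have "\<dots> \<le> (\<Sum>c\<in>A. p ^ card U * (p ^ card (S c - U) * b ^ j))"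
    proof (rule sum_mono)
      fix c assume c: "c \<in> A"
      have fU: "finite U" "finite (S c)" using Suc.prems A(2)[OF c] fin finite_subset by blast+
      have card: "card (U \<union> S c) = card U + card (S c - U)"
        using fU by (metis Un_Diff_cancel card_Un_disjoint Diff_disjoint finite_Diff)
      have "card (S c - U) \<le> l" using A(3)[OF c] card_mono[of "S c" "S c - U"] fU by auto
      then have "measure_pmf.expectation D (\<lambda>G. X G ^ j * I (U \<union> S c) G) \<le> p ^ card (U \<union> S c) * b ^ j"
        unfolding X_def I_def
        using Suc.prems A(2)[OF c] card by (intro Suc.IH) auto
      then show "measure_pmf.expectation D (\<lambda>G. X G ^ j * I (U \<union> S c) G)
          \<le> p ^ card U * (p ^ card (S c - U) * b ^ j)"
        by (simp add: card power_add mult.assoc)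
    qed
    also have "\<dots> = p ^ card U * ((\<Sum>c\<in>A. p ^ card (S c - U)) * b ^ j)"
      by (simp add: sum_distrib_left sum_distrib_right)
    also have "\<dots> \<le> p ^ card U * (b * b ^ j)"
      using core[of U] False Suc.prems b p by (intro mult_left_mono mult_right_mono) auto
    finally show ?thesis by (simp add: X_def I_def)
  qed
qed

text \<open>Markov's inequality for the \<open>k\<close>-th moment on the event that no member of
  \<open>KK\<close> is present, and a union bound over \<open>KK\<close> for the complement.
  Starting from the empty set, \<open>k\<close> steps use a budget of \<open>l * k\<close>.\<close>

lemma upper_tail_le_cores:
  fixes D :: "'e set pmf" and S :: "'c \<Rightarrow> 'e set"
  assumes fin: "finite E" and supp: "set_pmf D \<subseteq> Pow E"
    and prob: "\<And>U. U \<subseteq> E \<Longrightarrow> measure_pmf.prob D {G. U \<subseteq> G} = p ^ card U"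
    and A: "finite A" "\<And>c. c \<in> A \<Longrightarrow> S c \<subseteq> E" "\<And>c. c \<in> A \<Longrightarrow> card (S c) \<le> l"
    and b: "0 \<le> b" and p: "0 \<le> p" and t: "0 < t"
    and KK: "KK \<subseteq> Pow E"
    and core: "\<And>U. U \<subseteq> E \<Longrightarrow> card U + l \<le> l * k \<Longrightarrow> (\<And>K. K \<in> KK \<Longrightarrow> \<not> K \<subseteq> U) \<Longrightarrow>
                 (\<Sum>c\<in>A. p ^ card (S c - U)) \<le> b"
  shows "measure_pmf.prob D {G. t < real (card {c \<in> A. S c \<subseteq> G})}
         \<le> (b / t) ^ k + (\<Sum>K\<in>KK. p ^ card K)"
proof -
  define X where "X G = real (card {c \<in> A. S c \<subseteq> G})" for G
  define Z where "Z = {G. \<forall>K\<in>KK. \<not> K \<subseteq> G}"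
  have finD: "finite (set_pmf D)"
    using supp fin by (meson finite_Pow_iff finite_subset)
  have int: "integrable (measure_pmf D) f" for f :: "'e set \<Rightarrow> real"
    using finD by (rule integrable_measure_pmf_finite)
  have finKK: "finite KK" using KK fin by (meson finite_Pow_iff finite_subset)
  have "t ^ k * measure_pmf.prob D ({G. t < X G} \<inter> Z)
      = measure_pmf.expectation D (\<lambda>G. t ^ k * indicator ({G. t < X G} \<inter> Z) G)" by simp
  also have "\<dots> \<le> measure_pmf.expectation D (\<lambda>G. X G ^ k * indicator {G. {} \<subseteq> G \<and> (\<forall>K\<in>KK. \<not> K \<subseteq> G)} G)"
    using t by (intro integral_mono int) (auto simp: indicator_def Z_def X_def intro!: power_mono)
  also have "\<dots> \<le> p ^ card ({}::'e set) * b ^ k"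
    unfolding X_def
    by (rule truncated_moment_le[where E = E and l = l and m = "l * k"])
       (use fin supp prob A b p core in auto)
  finally have "measure_pmf.prob D ({G. t < X G} \<inter> Z) \<le> (b / t) ^ k"
    using t by (simp add: power_divide field_simps)
  moreover have "measure_pmf.prob D (\<Union>K\<in>KK. {G. K \<subseteq> G}) \<le> (\<Sum>K\<in>KK. measure_pmf.prob D {G. K \<subseteq> G})"
    using finKK by (intro measure_pmf.finite_measure_subadditive_finite) auto
  moreover have "(\<Sum>K\<in>KK. measure_pmf.prob D {G. K \<subseteq> G}) = (\<Sum>K\<in>KK. p ^ card K)"
    using KK prob by (intro sum.cong) auto
  moreover have "measure_pmf.prob D {G. t < X G}
      \<le> measure_pmf.prob D (({G. t < X G} \<inter> Z) \<union> (\<Union>K\<in>KK. {G. K \<subseteq> G}))"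
    by (rule measure_pmf.finite_measure_mono) (auto simp: Z_def)
  moreover have "\<dots> \<le> measure_pmf.prob D ({G. t < X G} \<inter> Z) + measure_pmf.prob D (\<Union>K\<in>KK. {G. K \<subseteq> G})"
    by (rule measure_Un_le) auto
  ultimately show ?thesis unfolding X_def by linarith
qed

text \<open>A subset of \<open>U\<close> maximising \<open>F K - \<theta> * card K\<close> loses at least \<open>\<theta>\<close> from the
  deletion of any of its elements.\<close>

lemma exists_core:
  fixes F :: "'e set \<Rightarrow> real"
  assumes "finite U" "card U \<le> m" "0 \<le> \<theta>"
  obtains K where "K \<subseteq> U" "F U - \<theta> * m \<le> F K" "\<And>e. e \<in> K \<Longrightarrow> \<theta> \<le> F K - F (K - {e})"
proof -
  define h where "h K = F K - \<theta> * card K" for K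
  have "finite (Pow U)" using assms by simp
  then obtain K where K: "K \<in> Pow U" "\<And>K'. K' \<in> Pow U \<Longrightarrow> h K' \<le> h K"
    using Max_in[of "h ` Pow U"] Max_ge[of "h ` Pow U"]
    by (metis (no_types, lifting) Pow_not_empty finite_imageI image_iff image_is_empty imageI)
  have "F U - \<theta> * m \<le> h U" using assms by (simp add: h_def mult_left_mono)
  also have "\<dots> \<le> h K" using K by auto
  also have "\<dots> \<le> F K" using assms by (simp add: h_def)
  finally have "F U - \<theta> * m \<le> F K" .
  moreover have "\<theta> \<le> F K - F (K - {e})" if "e \<in> K" for e
  proof -
    have "h (K - {e}) \<le> h K" using K by (meson Diff_subset Pow_iff subset_trans)
    moreover have "real (card K) = real (card (K - {e})) + 1"
      using that K(1) assms(1) by (metis Pow_iff finite_subset card_Suc_Diff1 of_nat_Suc add.commute)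
    ultimately show ?thesis by (simp add: h_def algebra_simps)
  qed
  ultimately show ?thesis using K that by auto
qed

lemma prob_random_subset_superset:
  assumes E: "finite E" and p: "0 \<le> p" "p \<le> 1" and U: "U \<subseteq> E"
  shows "measure_pmf.prob (map_pmf (\<lambda>f. {e \<in> E. f e}) (Pi_pmf E False (\<lambda>_. bernoulli_pmf p)))
           {G. U \<subseteq> G} = p ^ card U"
proof -
  have "measure_pmf.prob (map_pmf (\<lambda>f. {e \<in> E. f e}) (Pi_pmf E False (\<lambda>_. bernoulli_pmf p))) {G. U \<subseteq> G}
      = measure_pmf.prob (Pi_pmf E False (\<lambda>_. bernoulli_pmf p))
          (Pi E (\<lambda>e. if e \<in> U then {True} else UNIV))"
    unfolding measure_map_pmf using U
    by (intro arg_cong2[where f = measure]) (auto simp: Pi_def)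
  also have "\<dots> = (\<Prod>e\<in>E. if e \<in> U then p else 1)"
    using E p by (subst measure_Pi_pmf_Pi) (auto intro!: prod.cong simp: measure_pmf_single)
  also have "\<dots> = p ^ card U"
    using E U by (simp add: prod.If_cases Int_absorb1)
  finally show ?thesis .
qed

section \<open>Products of matrices\<close>

text \<open>The entry \<open>(a, b)\<close> of the product of the matrices
  \<open>f i, ..., f (i + r - 1)\<close>, that is, the total weight of the walks of length
  \<open>r\<close> from \<open>a\<close> to \<open>b\<close>. The index \<open>i\<close> is not
  reduced; periodicity modulo \<open>l\<close> is left to \<open>f\<close>, so that a product may
  start in any class and wrap around.\<close>

primrec mprod :: "nat \<Rightarrow> (nat \<Rightarrow> nat \<Rightarrow> nat \<Rightarrow> real) \<Rightarrow> nat \<Rightarrow> nat \<Rightarrow> nat \<Rightarrow> nat \<Rightarrow> real" where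
  "mprod n f i 0 a b = (if a = b then 1 else 0)"
| "mprod n f i (Suc r) a b = (\<Sum>v<n. f i a v * mprod n f (Suc i) r v b)"

lemma mprod_Suc_right:
  assumes "a < n" "b < n"
  shows "mprod n f i (Suc r) a b = (\<Sum>v<n. mprod n f i r a v * f (i + r) v b)"
  using assms(1)
proof (induction r arbitrary: i a)
  case 0
  then show ?case using assms by (simp add: if_distrib[of "\<lambda>x. _ * x"] if_distrib[of "\<lambda>x. x * _"] cong: if_cong)
next
  case (Suc r)
  have "mprod n f i (Suc (Suc r)) a b = (\<Sum>v<n. f i a v * (\<Sum>w<n. mprod n f (Suc i) r v w * f (Suc i + r) w b))"
    unfolding mprod.simps(2)[of n f i "Suc r"] by (intro sum.cong refl) (simp only: Suc.IH lessThan_iff)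
  also have "\<dots> = (\<Sum>w<n. (\<Sum>v<n. f i a v * mprod n f (Suc i) r v w) * f (i + Suc r) w b)"
    by (simp add: sum_distrib_left sum_distrib_right mult.assoc) (rule sum.swap)
  finally show ?case by simp
qed

lemma mprod_nonneg:
  assumes "\<And>i a b. 0 \<le> f i a b"
  shows "0 \<le> mprod n f i r a b"
  using assms by (induction r arbitrary: i a) (auto intro!: sum_nonneg)

lemma mprod_cong:
  assumes "\<And>k a b. i \<le> k \<Longrightarrow> k < i + r \<Longrightarrow> a < n \<Longrightarrow> b < n \<Longrightarrow> f k a b = g k a b" "a < n"
  shows "mprod n f i r a b = mprod n g i r a b"
  using assms by (induction r arbitrary: i a) auto

text \<open>Cyclic invariance of the trace. It allows the factor that belongs to a given edge to be
  placed first.\<close>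

lemma mprod_trace_rotate:
  assumes "\<And>i. f (i + l) = f i"
  shows "(\<Sum>a<n. mprod n f i l a a) = (\<Sum>a<n. mprod n f 0 l a a)"
proof (induction i)
  case (Suc i)
  show ?case
  proof (cases l)
    case (Suc r)
    have "(\<Sum>a<n. mprod n f (Suc i) l a a) = (\<Sum>a<n. \<Sum>v<n. mprod n f (Suc i) r a v * f i v a)"
      using assms[of i] unfolding Suc by (intro sum.cong refl) (simp only: mprod_Suc_right lessThan_iff add_Suc_right add_Suc)
    also have "\<dots> = (\<Sum>a<n. mprod n f i l a a)"
      unfolding Suc mprod.simps by (subst sum.swap) (simp add: mult.commute)
    finally show ?thesis using Suc.IH by simp
  qed simp
qed simp

lemma sum_PiE_insert:
  assumes "x \<notin> S"
  shows "(\<Sum>c\<in>PiE (insert x S) B. h c) = (\<Sum>v\<in>B x. \<Sum>c\<in>PiE S B. h (c(x := v)))"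
proof -
  have "(\<Sum>c\<in>PiE (insert x S) B. h c) = (\<Sum>(v, c)\<in>B x \<times> PiE S B. h (c(x := v)))"
    unfolding PiE_insert_eq
    by (subst sum.reindex[OF inj_combinator[OF assms]]) (simp add: case_prod_unfold)
  then show ?thesis by (simp add: sum.cartesian_product)
qed

text \<open>The induction removes the last vertex of the path. The function \<open>g\<close> depends
  on both ends so that it can absorb the last factor; later it supplies the closing edge of a
  cycle.\<close>

lemma sum_paths_eq_mprod:
  "(\<Sum>c\<in>PiE {..<Suc r} (\<lambda>_. {..<n}). (\<Prod>i<r. f i (c i) (c (Suc i))) * g (c 0) (c r))
   = (\<Sum>a<n. \<Sum>b<n. mprod n f 0 r a b * g a b)"
proof (induction r arbitrary: g)
  case 0
  have "(\<Sum>c\<in>PiE {..<Suc 0} (\<lambda>_. {..<n}). g (c 0) (c 0)) = (\<Sum>a<n. g a a)"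
    using sum_PiE_insert[of 0 "{}" "\<lambda>c. g (c 0) (c 0)" "\<lambda>_. {..<n}"] by (simp add: lessThan_Suc)
  moreover have "(\<Sum>b<n. mprod n f 0 0 a b * g a b) = g a a" if "a < n" for a
    using that by (simp add: if_distrib[of "\<lambda>x. x * _"] cong: if_cong)
  ultimately show ?case by simp
next
  case (Suc r)
  have "(\<Sum>c\<in>PiE {..<Suc (Suc r)} (\<lambda>_. {..<n}). (\<Prod>i<Suc r. f i (c i) (c (Suc i))) * g (c 0) (c (Suc r)))
      = (\<Sum>v<n. \<Sum>c\<in>PiE {..<Suc r} (\<lambda>_. {..<n}). (\<Prod>i<r. f i (c i) (c (Suc i))) * (f r (c r) v * g (c 0) v))"
    unfolding lessThan_Suc[of "Suc r"]
    by (subst sum_PiE_insert) (auto intro!: sum.cong prod.cong simp: mult.assoc)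
  also have "\<dots> = (\<Sum>v<n. \<Sum>a<n. \<Sum>b<n. mprod n f 0 r a b * (f r b v * g a v))"
    by (intro sum.cong refl Suc.IH[of "\<lambda>a b. f r b _ * g a _"])
  also have "\<dots> = (\<Sum>a<n. \<Sum>v<n. (\<Sum>b<n. mprod n f 0 r a b * f r b v) * g a v)"
    by (subst sum.swap) (simp add: sum_distrib_left sum_distrib_right mult.assoc)
  also have "\<dots> = (\<Sum>a<n. \<Sum>v<n. mprod n f 0 (Suc r) a v * g a v)"
    by (intro sum.cong refl) (simp add: mprod_Suc_right del: mprod.simps(2))
  finally show ?case .
qed

lemma sum_closed_walks_eq_trace:
  assumes "0 < l"
  shows "(\<Sum>c\<in>PiE {..<l} (\<lambda>_. {..<n}). \<Prod>i<l. f i (c i) (c (Suc i mod l)))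
       = (\<Sum>a<n. mprod n f 0 l a a)"
proof -
  obtain r where l: "l = Suc r" using assms by (cases l) auto
  have "(\<Prod>i<l. f i (c i) (c (Suc i mod l))) = (\<Prod>i<r. f i (c i) (c (Suc i))) * f r (c r) (c 0)" for c :: "nat \<Rightarrow> nat"
    unfolding l by (auto intro!: prod.cong)
  then have "(\<Sum>c\<in>PiE {..<l} (\<lambda>_. {..<n}). \<Prod>i<l. f i (c i) (c (Suc i mod l)))
      = (\<Sum>a<n. \<Sum>b<n. mprod n f 0 r a b * f r b a)"
    using sum_paths_eq_mprod[where g = "\<lambda>a b. f r b a"] by (simp add: l)
  also have "\<dots> = (\<Sum>a<n. mprod n f 0 l a a)"
    unfolding l by (intro sum.cong refl) (simp add: mprod_Suc_right del: mprod.simps(2))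
  finally show ?thesis .
qed

text \<open>By Cauchy-Schwarz each further factor costs at most \<open>h\<close>, the bound for its
  squared Hilbert-Schmidt norm. Keeping row \<open>a\<close> of the first factor separate is what
  makes a vertex degree visible later.\<close>

lemma mprod_row_sum_squares_le:
  assumes hs: "\<And>k. (\<Sum>a<n. \<Sum>b<n. (f k a b)\<^sup>2) \<le> h" and "a < n"
  shows "(\<Sum>b<n. (mprod n f i (Suc r) a b)\<^sup>2) \<le> (\<Sum>v<n. (f i a v)\<^sup>2) * h ^ r"
proof (induction r)
  case 0
  then show ?case using assms(2) by (simp add: mprod_Suc_right if_distrib[of "\<lambda>x. x * _"] if_distrib[of "\<lambda>x. _ * x"] cong: if_cong)
next
  case (Suc r)
  have h0: "0 \<le> h" using hs[of 0] by (rule order_trans[rotated]) (intro sum_nonneg zero_le_power2)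
  have "(\<Sum>b<n. (mprod n f i (Suc (Suc r)) a b)\<^sup>2)
      = (\<Sum>b<n. (\<Sum>v<n. mprod n f i (Suc r) a v * f (i + Suc r) v b)\<^sup>2)"
    using assms(2) by (intro sum.cong refl) (simp only: mprod_Suc_right lessThan_iff)
  also have "\<dots> \<le> (\<Sum>b<n. (\<Sum>v<n. (mprod n f i (Suc r) a v)\<^sup>2) * (\<Sum>v<n. (f (i + Suc r) v b)\<^sup>2))"
    by (intro sum_mono Cauchy_Schwarz_ineq_sum)
  also have "\<dots> = (\<Sum>v<n. (mprod n f i (Suc r) a v)\<^sup>2) * (\<Sum>v<n. \<Sum>b<n. (f (i + Suc r) v b)\<^sup>2)"
    by (subst sum.swap[of _ "{..<n}" "{..<n}"]) (simp add: sum_distrib_left)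
  also have "\<dots> \<le> ((\<Sum>v<n. (f i a v)\<^sup>2) * h ^ r) * h"
    using Suc hs h0 by (intro mult_mono mult_nonneg_nonneg sum_nonneg) auto
  finally show ?case by (simp add: mult_ac)
qed

lemma mprod_sum_squares_le:
  assumes hs: "\<And>k. (\<Sum>a<n. \<Sum>b<n. (f k a b)\<^sup>2) \<le> h"
  shows "(\<Sum>a<n. \<Sum>b<n. (mprod n f i (Suc r) a b)\<^sup>2) \<le> h ^ Suc r"
proof -
  have h0: "0 \<le> h" using hs[of 0] by (rule order_trans[rotated]) (intro sum_nonneg zero_le_power2)
  have "(\<Sum>a<n. \<Sum>b<n. (mprod n f i (Suc r) a b)\<^sup>2) \<le> (\<Sum>a<n. (\<Sum>v<n. (f i a v)\<^sup>2) * h ^ r)"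
    using hs by (intro sum_mono mprod_row_sum_squares_le) auto
  also have "\<dots> = (\<Sum>a<n. \<Sum>v<n. (f i a v)\<^sup>2) * h ^ r" by (simp add: sum_distrib_right)
  also have "\<dots> \<le> h * h ^ r" using hs h0 by (intro mult_right_mono) auto
  finally show ?thesis by simp
qed

text \<open>The entry is the inner product of row \<open>a\<close> of all factors but the last with
  column \<open>b\<close> of the last one. So the first factor enters through a row, the last
  through a column, and only the \<open>r\<close> factors in between cost \<open>h\<close>.\<close>

lemma mprod_entry_square_le:
  assumes hs: "\<And>k. (\<Sum>a<n. \<Sum>b<n. (f k a b)\<^sup>2) \<le> h" and "a < n" "b < n"
  shows "(mprod n f i (Suc (Suc r)) a b)\<^sup>2
         \<le> (\<Sum>v<n. (f i a v)\<^sup>2) * h ^ r * (\<Sum>v<n. (f (i + Suc r) v b)\<^sup>2)"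
proof -
  have "(mprod n f i (Suc (Suc r)) a b)\<^sup>2 = (\<Sum>v<n. mprod n f i (Suc r) a v * f (i + Suc r) v b)\<^sup>2"
    using assms by (simp only: mprod_Suc_right)
  also have "\<dots> \<le> (\<Sum>v<n. (mprod n f i (Suc r) a v)\<^sup>2) * (\<Sum>v<n. (f (i + Suc r) v b)\<^sup>2)"
    by (rule Cauchy_Schwarz_ineq_sum)
  also have "\<dots> \<le> (\<Sum>v<n. (f i a v)\<^sup>2) * h ^ r * (\<Sum>v<n. (f (i + Suc r) v b)\<^sup>2)"
    using assms by (intro mult_right_mono mprod_row_sum_squares_le sum_nonneg) auto
  finally show ?thesis .
qed

text \<open>The trace is the inner product of the first factor with the transpose of the product of
  the others, and both Hilbert-Schmidt norms are bounded.\<close>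

lemma mprod_trace_square_le:
  assumes hs: "\<And>k. (\<Sum>a<n. \<Sum>b<n. (f k a b)\<^sup>2) \<le> h" and "2 \<le> l"
  shows "(\<Sum>a<n. mprod n f i l a a)\<^sup>2 \<le> h ^ l"
proof -
  obtain r where "l = 2 + r" using assms(2) le_Suc_ex by blast
  then have l: "l = Suc (Suc r)" by simp
  have h0: "0 \<le> h" using hs[of 0] by (rule order_trans[rotated]) (intro sum_nonneg zero_le_power2)
  have "(\<Sum>a<n. mprod n f i l a a) = (\<Sum>(a, v)\<in>{..<n} \<times> {..<n}. f i a v * mprod n f (Suc i) (Suc r) v a)"
    unfolding l mprod.simps(2)[of n f i "Suc r"] by (simp only: sum.cartesian_product)
  then have "(\<Sum>a<n. mprod n f i l a a)\<^sup>2
      \<le> (\<Sum>(a, v)\<in>{..<n} \<times> {..<n}. (f i a v)\<^sup>2) * (\<Sum>(a, v)\<in>{..<n} \<times> {..<n}. (mprod n f (Suc i) (Suc r) v a)\<^sup>2)"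
    using Cauchy_Schwarz_ineq_sum[of "\<lambda>(a, v). f i a v" "\<lambda>(a, v). mprod n f (Suc i) (Suc r) v a" "{..<n} \<times> {..<n}"]
    by (simp add: case_prod_unfold del: mprod.simps)
  also have "\<dots> = (\<Sum>a<n. \<Sum>v<n. (f i a v)\<^sup>2) * (\<Sum>v<n. \<Sum>a<n. (mprod n f (Suc i) (Suc r) v a)\<^sup>2)"
    unfolding sum.cartesian_product[symmetric] by (subst (2) sum.swap) (rule refl)
  also have "\<dots> \<le> h * h ^ Suc r"
    using hs h0 by (intro mult_mono mprod_sum_squares_le) (auto intro!: sum_nonneg)
  finally show ?thesis by (simp add: l)
qed

lemma mprod_col_sum_le:
  assumes f0: "\<And>i a b. 0 \<le> f i a b" and R: "\<And>i b. b < n \<Longrightarrow> (\<Sum>a<n. f i a b) \<le> R"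
    and "b < n" "0 \<le> R"
  shows "(\<Sum>a<n. mprod n f i r a b) \<le> R ^ r"
proof (induction r arbitrary: i)
  case 0
  then show ?case using assms by simp
next
  case (Suc r)
  have "(\<Sum>a<n. mprod n f i (Suc r) a b) = (\<Sum>v<n. (\<Sum>a<n. f i a v) * mprod n f (Suc i) r v b)"
    unfolding mprod.simps sum_distrib_right by (rule sum.swap)
  also have "\<dots> \<le> (\<Sum>v<n. R * mprod n f (Suc i) r v b)"
    using R f0 by (intro sum_mono mult_right_mono mprod_nonneg) auto
  also have "\<dots> \<le> R * R ^ r"
    unfolding sum_distrib_left[symmetric] using Suc.IH assms(4) by (intro mult_left_mono) auto
  finally show ?case by simp
qed

text \<open>The factors are replaced one at a time. Each replacement costs \<open>p\<close> times a
  column sum of the remaining product of \<open>f\<close>, multiplied by row sums of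
  \<open>g\<close> for the factors already replaced; \<open>1 \<le> R\<close> lets all these errors
  share the power \<open>R ^ r\<close>.\<close>

lemma mprod_perturb_le:
  assumes f0: "\<And>i a b. 0 \<le> f i a b" and g0: "\<And>i a b. 0 \<le> g i a b"
    and fg: "\<And>i a b. f i a b \<le> g i a b + p" and "0 \<le> p"
    and Rg: "\<And>i a. a < n \<Longrightarrow> (\<Sum>b<n. g i a b) \<le> R"
    and R: "\<And>i b. b < n \<Longrightarrow> (\<Sum>a<n. f i a b) \<le> R" and "1 \<le> R"
    and "a < n" "b < n"
  shows "mprod n f i r a b \<le> mprod n g i r a b + real r * p * R ^ r"
  using \<open>a < n\<close>
proof (induction r arbitrary: i a)
  case (Suc r)
  have "mprod n f i (Suc r) a b \<le> (\<Sum>v<n. (g i a v + p) * mprod n f (Suc i) r v b)"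
    unfolding mprod.simps using fg f0 by (intro sum_mono mult_right_mono mprod_nonneg) auto
  also have "\<dots> = (\<Sum>v<n. g i a v * mprod n f (Suc i) r v b) + p * (\<Sum>v<n. mprod n f (Suc i) r v b)"
    by (simp add: algebra_simps sum.distrib sum_distrib_left)
  also have "\<dots> \<le> (\<Sum>v<n. g i a v * (mprod n g (Suc i) r v b + real r * p * R ^ r)) + p * R ^ r"
    using Suc.IH g0 f0 R assms by (intro add_mono sum_mono mult_left_mono mprod_col_sum_le) auto
  also have "(\<Sum>v<n. g i a v * (mprod n g (Suc i) r v b + real r * p * R ^ r))
      = mprod n g i (Suc r) a b + (\<Sum>v<n. g i a v) * (real r * p * R ^ r)"
    by (simp add: distrib_left sum.distrib sum_distrib_right)
  also have "\<dots> \<le> mprod n g i (Suc r) a b + R * (real r * p * R ^ r)"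
    using Rg Suc.prems assms by (intro add_left_mono mult_right_mono) auto
  finally have "mprod n f i (Suc r) a b \<le> mprod n g i (Suc r) a b + real r * p * R ^ Suc r + p * R ^ r"
    by (simp add: algebra_simps)
  also have "p * R ^ r \<le> p * R ^ Suc r"
    using assms by (intro mult_left_mono) (auto intro!: power_increasing)
  finally show ?case by (simp add: algebra_simps del: mprod.simps)
qed simp

section \<open>Counting edge sets with given degrees\<close>

text \<open>A single term of the binomial expansion of \<open>(1 + y)^N\<close> at
  \<open>y = s / B\<close> is at most \<open>exp (y * N)\<close>, and
  \<open>y * N \<le> s\<close>.\<close>

lemma card_subsets_le:
  assumes "finite E" "0 < s" "real (card E) \<le> B"
  shows "real (card {I. I \<subseteq> E \<and> card I = s}) \<le> (exp 1 * B / s) ^ s"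
proof (cases "B = 0")
  case True
  then have "E = {}" using assms by simp
  then have none: "{I. I \<subseteq> E \<and> card I = s} = {}" using assms(2) by auto
  show ?thesis unfolding none using assms True by simp
next
  case False
  then have B: "0 < B" using assms(3) by (smt (verit) of_nat_0_le_iff)
  define N where "N = card E"
  define y where "y = s / B"
  have y: "0 < y" using B assms(2) by (simp add: y_def)
  have "real (N choose s) * y ^ s \<le> (\<Sum>k\<le>N. real (N choose k) * y ^ k)"
  proof (cases "s \<le> N")
    case True
    then show ?thesis using y by (intro member_le_sum) auto
  next
    case False
    then show ?thesis using y by (simp add: binomial_eq_0 sum_nonneg)
  qed
  also have "\<dots> = (1 + y) ^ N" using binomial_ring[of y 1 N] by (simp add: add.commute)
  also have "\<dots> \<le> exp y ^ N" using y by (intro power_mono) auto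
  also have "\<dots> = exp (y * N)" by (simp add: exp_of_nat2_mult mult.commute)
  also have "\<dots> \<le> exp s" using B assms(3) y by (simp add: y_def N_def field_simps mult_left_mono)
  finally have "real (N choose s) * y ^ s \<le> exp 1 ^ s" using exp_of_nat_mult[of s "1::real"] by simp
  then have "real (N choose s) \<le> (exp 1 / y) ^ s" using y by (simp add: field_simps power_divide)
  moreover have "card {I. I \<subseteq> E \<and> card I = s} = N choose s" using n_subsets[OF assms(1)] by (simp add: N_def)
  moreover have "exp 1 / y = exp 1 * B / s" by (simp add: y_def)
  ultimately show ?thesis by simp
qed

text \<open>Each advice \<open>d\<close> is weighted by \<open>4 ^ s * (1/z) powr v * (\<Prod>x. z^[d x \<noteq> 0] / 2 ^ d x) \<ge> 1\<close>,
  and the sum of these weights factorises over \<open>V\<close>.\<close>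

lemma card_degree_advice_le:
  fixes V :: "'v set" and z v :: real
  assumes "finite V" "0 < z" "z \<le> 1"
  shows "real (card {d \<in> PiE V (\<lambda>_. {..2 * s}). (\<Sum>x\<in>V. d x) \<le> 2 * s \<and> real (card {x \<in> V. d x \<noteq> 0}) \<le> v})
         \<le> 4 ^ s * (1 / z) powr v * exp (z * card V)"
proof -
  define A where "A = {d \<in> PiE V (\<lambda>_. {..2 * s}). (\<Sum>x\<in>V. d x) \<le> 2 * s \<and> real (card {x \<in> V. d x \<noteq> 0}) \<le> v}"
  define w where "w d = (\<Prod>x\<in>V. (if d x \<noteq> 0 then z else 1) * (1 / 2) ^ d x)" for d :: "'v \<Rightarrow> nat"
  have fin: "finite (PiE V (\<lambda>_. {..2 * s}))" using assms by (simp add: finite_PiE)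
  have w0: "0 \<le> w d" for d using assms by (auto simp: w_def intro!: prod_nonneg)
  have big: "1 \<le> 4 ^ s * (1 / z) powr v * w d" if "d \<in> A" for d
  proof -
    have "w d = z ^ card {x \<in> V. d x \<noteq> 0} * (1 / 2) ^ (\<Sum>x\<in>V. d x)"
      using assms(1) by (simp add: w_def prod.distrib prod.If_cases power_sum Int_def)
    moreover have "(1 / 4) ^ s \<le> (1 / 2 :: real) ^ (\<Sum>x\<in>V. d x)"
    proof -
      have "(1 / 2 :: real) ^ (2 * s) \<le> (1 / 2) ^ (\<Sum>x\<in>V. d x)"
        using that by (intro power_decreasing) (auto simp: A_def)
      then show ?thesis by (simp add: power_mult power2_eq_square)
    qed
    moreover have "(1 / (1 / z) powr v) \<le> z ^ card {x \<in> V. d x \<noteq> 0}"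
    proof -
      have "z powr v \<le> z powr (card {x \<in> V. d x \<noteq> 0})"
        using that assms by (intro powr_mono') (auto simp: A_def)
      then show ?thesis using assms by (simp add: powr_realpow powr_divide)
    qed
    ultimately have "(1 / (1 / z) powr v) * (1 / 4) ^ s \<le> w d"
      using assms by (metis (no_types, lifting) mult_mono divide_nonneg_nonneg order.strict_implies_order powr_ge_zero zero_le_divide_1_iff zero_le_numeral zero_le_power)
    then show ?thesis using assms by (simp add: field_simps power_divide)
  qed
  have "real (card A) = (\<Sum>d\<in>A. 1)" by simp
  also have "\<dots> \<le> (\<Sum>d\<in>A. 4 ^ s * (1 / z) powr v * w d)" by (intro sum_mono big)
  also have "\<dots> \<le> (\<Sum>d\<in>PiE V (\<lambda>_. {..2 * s}). 4 ^ s * (1 / z) powr v * w d)"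
    using fin w0 assms by (intro sum_mono2) (auto simp: A_def)
  also have "\<dots> = 4 ^ s * (1 / z) powr v * (\<Prod>x\<in>V. \<Sum>j\<in>{..2 * s}. (if j \<noteq> 0 then z else 1) * (1 / 2) ^ j)"
    unfolding w_def using assms(1) by (subst prod_sum_PiE) (auto simp: sum_distrib_left)
  also have "\<dots> \<le> 4 ^ s * (1 / z) powr v * (\<Prod>x\<in>V. exp z)"
  proof (intro mult_left_mono prod_mono conjI)
    have geo: "(\<Sum>j\<in>{1..m}. (1 / 2 :: real) ^ j) \<le> 1" for m :: nat
    proof -
      have "(\<Sum>j\<in>{1..m}. (1 / 2 :: real) ^ j) = 1 - (1 / 2) ^ m" by (induction m) auto
      then show ?thesis by simp
    qed
    have "(\<Sum>j\<in>{..2 * s}. (if j \<noteq> 0 then z else 1) * (1 / 2) ^ j)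
        = 1 + (\<Sum>j\<in>{1..2 * s}. z * (1 / 2) ^ j)"
    proof -
      have "{..2 * s} = insert 0 {1..2 * s}" by auto
      then show ?thesis by simp
    qed
    also have "\<dots> \<le> 1 + z * 1"
      unfolding sum_distrib_left[symmetric] using geo[of "2 * s"] assms by (intro add_left_mono mult_left_mono) auto
    finally show "(\<Sum>j\<in>{..2 * s}. (if j \<noteq> 0 then z else 1) * (1 / 2) ^ j) \<le> exp z"
      using exp_ge_add_one_self[of z] by linarith
  qed (use assms in \<open>auto intro!: sum_nonneg\<close>)
  also have "\<dots> = 4 ^ s * (1 / z) powr v * exp (z * card V)" by (simp add: exp_of_nat2_mult mult.commute)
  finally show ?thesis by (simp add: A_def)
qed

text \<open>The degrees determine a set of at most \<open>s * (4 * n / H + 4 * s / Q)\<close> admissible edges.\<close>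

lemma card_edge_sets_le:
  fixes src dst :: "'e \<Rightarrow> 'v" and H Q z v :: real
  assumes T: "finite T" "finite V" "src ` T \<subseteq> V" "dst ` T \<subseteq> V" "inj_on (\<lambda>t. (src t, dst t)) T"
    and n: "\<And>x. x \<in> V \<Longrightarrow> card {t \<in> T. src t = x} \<le> n" "\<And>x. x \<in> V \<Longrightarrow> card {t \<in> T. dst t = x} \<le> n"
    and HQ: "0 < H" "0 < Q" and z: "0 < z" "z \<le> 1" and s: "0 < s"
    and \<I>: "\<And>I. I \<in> \<I> \<Longrightarrow> I \<subseteq> T" "\<And>I. I \<in> \<I> \<Longrightarrow> card I = s"
    and advice: "\<And>I. I \<in> \<I> \<Longrightarrow> \<exists>d. (\<Sum>x\<in>V. d x) \<le> 2 * s \<and> real (card {x \<in> V. d x \<noteq> 0}) \<le> v \<and>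
        (\<forall>t\<in>I. H \<le> real (d (src t)) \<or> H \<le> real (d (dst t)) \<or> Q \<le> real (d (src t)) * real (d (dst t)))"
  shows "real (card \<I>) \<le> 4 ^ s * (1 / z) powr v * exp (z * card V) * (exp 1 * (4 * real n / H + 4 * real s / Q)) ^ s"
proof -
  define A where "A = {d \<in> PiE V (\<lambda>_. {..2 * s}). (\<Sum>x\<in>V. d x) \<le> 2 * s \<and> real (card {x \<in> V. d x \<noteq> 0}) \<le> v}"
  define E where "E d = {t \<in> T. H \<le> real (d (src t)) \<or> H \<le> real (d (dst t)) \<or> Q \<le> real (d (src t)) * real (d (dst t))}"
    for d :: "'v \<Rightarrow> nat"
  define B where "B = real s * (4 * real n / H + 4 * real s / Q)"
  have finA: "finite A" using T by (simp add: A_def finite_PiE)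
  have cE: "real (card (E d)) \<le> B" if d: "d \<in> A" for d
  proof -
    have sumd: "(\<Sum>x\<in>V. real (d x)) \<le> 2 * s"
      using d by (simp add: A_def flip: of_nat_sum)
    have "real (card (E d)) = (\<Sum>t\<in>E d. 1)" by simp
    \<comment> \<open>An admissible edge makes one of the three quotients at least 1. When they are
      summed over all of \<open>T\<close>, the first two use that a vertex has at most
      \<open>n\<close> edges on either side, the third that the pair of end vertices determines the
      edge.\<close>
    also have "\<dots> \<le> (\<Sum>t\<in>E d. d (src t) / H + d (dst t) / H + real (d (src t)) * d (dst t) / Q)"
    proof (rule sum_mono)
      fix t assume "t \<in> E d"
      then consider "1 \<le> d (src t) / H" | "1 \<le> d (dst t) / H" | "1 \<le> real (d (src t)) * d (dst t) / Q"
        using HQ by (auto simp: E_def)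
      moreover have "0 \<le> d (src t) / H" "0 \<le> d (dst t) / H" "0 \<le> real (d (src t)) * d (dst t) / Q"
        using HQ by auto
      ultimately show "1 \<le> d (src t) / H + d (dst t) / H + real (d (src t)) * d (dst t) / Q"
        by cases linarith+
    qed
    also have "\<dots> \<le> (\<Sum>t\<in>T. d (src t) / H + d (dst t) / H + real (d (src t)) * d (dst t) / Q)"
      using T HQ by (intro sum_mono2) (auto simp: E_def)
    also have "\<dots> = (\<Sum>t\<in>T. real (d (src t))) / H + (\<Sum>t\<in>T. real (d (dst t))) / H
        + (\<Sum>t\<in>T. real (d (src t)) * d (dst t)) / Q"
      by (simp add: sum.distrib sum_divide_distrib)
    also have "(\<Sum>t\<in>T. real (d (src t))) \<le> real n * (2 * s)"
    proof -
      have "(\<Sum>t\<in>T. real (d (src t))) = (\<Sum>x\<in>V. \<Sum>t\<in>{t \<in> T. src t = x}. real (d (src t)))"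
        using T by (intro sum.group[symmetric]) auto
      also have "\<dots> = (\<Sum>x\<in>V. real (card {t \<in> T. src t = x}) * d x)" by (auto intro!: sum.cong)
      also have "\<dots> \<le> (\<Sum>x\<in>V. real n * d x)" using n by (intro sum_mono mult_right_mono) auto
      also have "\<dots> \<le> real n * (2 * s)" unfolding sum_distrib_left[symmetric] using sumd by (intro mult_left_mono) auto
      finally show ?thesis .
    qed
    also have "(\<Sum>t\<in>T. real (d (dst t))) \<le> real n * (2 * s)"
    proof -
      have "(\<Sum>t\<in>T. real (d (dst t))) = (\<Sum>x\<in>V. \<Sum>t\<in>{t \<in> T. dst t = x}. real (d (dst t)))"
        using T by (intro sum.group[symmetric]) auto
      also have "\<dots> = (\<Sum>x\<in>V. real (card {t \<in> T. dst t = x}) * d x)" by (auto intro!: sum.cong)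
      also have "\<dots> \<le> (\<Sum>x\<in>V. real n * d x)" using n by (intro sum_mono mult_right_mono) auto
      also have "\<dots> \<le> real n * (2 * s)" unfolding sum_distrib_left[symmetric] using sumd by (intro mult_left_mono) auto
      finally show ?thesis .
    qed
    also have "(\<Sum>t\<in>T. real (d (src t)) * d (dst t)) \<le> real (2 * s) * real (2 * s)"
    proof -
      have "(\<Sum>t\<in>T. real (d (src t)) * d (dst t)) = (\<Sum>(x, y)\<in>(\<lambda>t. (src t, dst t)) ` T. real (d x) * d y)"
        using T(5) by (simp add: sum.reindex)
      also have "\<dots> \<le> (\<Sum>(x, y)\<in>V \<times> V. real (d x) * d y)"
        using T by (intro sum_mono2) auto
      also have "\<dots> = (\<Sum>x\<in>V. real (d x)) * (\<Sum>y\<in>V. real (d y))"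
        by (simp add: sum.cartesian_product[symmetric] sum_product)
      also have "\<dots> \<le> real (2 * s) * real (2 * s)" using sumd by (intro mult_mono) (auto intro!: sum_nonneg)
      finally show ?thesis .
    qed
    finally have "real (card (E d)) \<le> real n * (2 * s) / H + real n * (2 * s) / H + real (2 * s) * real (2 * s) / Q"
      using HQ by (simp add: divide_right_mono)
    also have "\<dots> = B" by (simp add: B_def field_simps)
    finally show ?thesis .
  qed
  have "\<I> \<subseteq> (\<Union>d\<in>A. {I. I \<subseteq> E d \<and> card I = s})"
  proof
    fix I assume I: "I \<in> \<I>"
    obtain d where d: "(\<Sum>x\<in>V. d x) \<le> 2 * s" "real (card {x \<in> V. d x \<noteq> 0}) \<le> v"
        "\<forall>t\<in>I. H \<le> real (d (src t)) \<or> H \<le> real (d (dst t)) \<or> Q \<le> real (d (src t)) * real (d (dst t))"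
      using advice[OF I] by auto
    have "restrict d V \<in> A"
    proof -
      have "d x \<le> 2 * s" if "x \<in> V" for x
        using member_le_sum[of x V d] that T(2) d(1) by auto
      moreover have "{x \<in> V. restrict d V x \<noteq> 0} = {x \<in> V. d x \<noteq> 0}" by auto
      ultimately show ?thesis using d by (auto simp: A_def)
    qed
    moreover have "I \<subseteq> E (restrict d V)"
    proof
      fix t assume t: "t \<in> I"
      then have "t \<in> T" "src t \<in> V" "dst t \<in> V" using \<I>(1)[OF I] T(3,4) by auto
      then show "t \<in> E (restrict d V)" using bspec[OF d(3) t] by (simp add: E_def)
    qed
    ultimately show "I \<in> (\<Union>d\<in>A. {I. I \<subseteq> E d \<and> card I = s})" using \<I>(2)[OF I] by auto
  qed
  moreover have "finite (\<Union>d\<in>A. {I. I \<subseteq> E d \<and> card I = s})"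
    using finA T by (auto simp: E_def)
  ultimately have "card \<I> \<le> card (\<Union>d\<in>A. {I. I \<subseteq> E d \<and> card I = s})" by (intro card_mono)
  also have "\<dots> \<le> (\<Sum>d\<in>A. card {I. I \<subseteq> E d \<and> card I = s})" using finA by (rule card_UN_le)
  finally have "real (card \<I>) \<le> (\<Sum>d\<in>A. real (card {I. I \<subseteq> E d \<and> card I = s}))"
    by (simp flip: of_nat_sum)
  also have "\<dots> \<le> (\<Sum>d\<in>A. (exp 1 * B / s) ^ s)"
    using T s cE by (intro sum_mono card_subsets_le) (auto simp: E_def)
  also have "\<dots> = real (card A) * (exp 1 * (4 * real n / H + 4 * real s / Q)) ^ s"
    using s by (simp add: B_def)
  also have "\<dots> \<le> 4 ^ s * (1 / z) powr v * exp (z * card V) * (exp 1 * (4 * real n / H + 4 * real s / Q)) ^ s"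
    unfolding A_def using HQ T z by (intro mult_right_mono card_degree_advice_le) auto
  finally show ?thesis .
qed

section \<open>Degrees in sparse sets of edges\<close>

definition deg :: "('e \<Rightarrow> 'v) \<Rightarrow> ('e \<Rightarrow> 'v) \<Rightarrow> 'e set \<Rightarrow> 'v \<Rightarrow> nat" where
  "deg src dst I x = card {t \<in> I. src t = x} + card {t \<in> I. dst t = x}"

lemma sum_card_fibres:
  assumes "finite I" "finite X"
  shows "(\<Sum>x\<in>X. card {t \<in> I. g t = x}) = card {t \<in> I. g t \<in> X}"
proof -
  have "(\<Sum>x\<in>X. card {t \<in> I. g t = x}) = card (\<Union>x\<in>X. {t \<in> I. g t = x})"
    using assms by (intro card_UN_disjoint[symmetric]) auto
  also have "(\<Union>x\<in>X. {t \<in> I. g t = x}) = {t \<in> I. g t \<in> X}" by auto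
  finally show ?thesis .
qed

lemma sum_deg:
  assumes "finite I" "finite X"
  shows "(\<Sum>x\<in>X. deg src dst I x) = card {t \<in> I. src t \<in> X} + card {t \<in> I. dst t \<in> X}"
  using assms by (simp add: deg_def sum.distrib sum_card_fibres)

lemma sum_deg_V:
  assumes "finite I" "finite V" "src ` I \<subseteq> V" "dst ` I \<subseteq> V"
  shows "(\<Sum>x\<in>V. deg src dst I x) = 2 * card I"
proof -
  have "{t \<in> I. src t \<in> V} = I" "{t \<in> I. dst t \<in> V} = I" using assms by auto
  then show ?thesis using assms by (simp add: sum_deg)
qed

text \<open>The advice records the degrees of hubs (degree at least \<open>H\<close>) and of the
  ends of edges without a hub, and is 0 elsewhere: a non-hub whose edges all lead to hubs need not
  be named. Recorded vertices have degree at least 2, so the degree sum \<open>2 * card I\<close>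
  allows at most \<open>card I\<close> of them. For the sharper count, an edge without a hub has
  degree product at least \<open>Q \<ge> D^2\<close>, so that no edge joins two recorded vertices of
  degree below \<open>D\<close>.\<close>

lemma hub_advice:
  fixes I :: "'e set" and V :: "'v set" and src dst and H Q :: real
  defines "\<delta> \<equiv> deg src dst I"
  assumes fin: "finite I" "finite V" "src ` I \<subseteq> V" "dst ` I \<subseteq> V" and H: "2 \<le> H"
    and edge: "\<And>t. t \<in> I \<Longrightarrow> H \<le> \<delta> (src t) \<or> H \<le> \<delta> (dst t) \<or>
        (Q \<le> real (\<delta> (src t)) * \<delta> (dst t) \<and> 2 \<le> \<delta> (src t) \<and> 2 \<le> \<delta> (dst t))"
  obtains d where "(\<Sum>x\<in>V. d x) \<le> 2 * card I" "card {x \<in> V. d x \<noteq> 0} \<le> card I"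
    "\<And>D. 2 \<le> D \<Longrightarrow> D \<le> H \<Longrightarrow> D\<^sup>2 \<le> Q \<Longrightarrow>
       real (card {x \<in> V. d x \<noteq> 0}) \<le> card I / 2 + 2 * card I / D"
    "\<forall>t\<in>I. H \<le> real (d (src t)) \<or> H \<le> real (d (dst t)) \<or> Q \<le> real (d (src t)) * real (d (dst t))"
proof -
  define nonhub where "nonhub t \<longleftrightarrow> \<delta> (src t) < H \<and> \<delta> (dst t) < H" for t
  define active where "active = {x \<in> V. H \<le> \<delta> x \<or> (\<exists>t\<in>I. nonhub t \<and> (src t = x \<or> dst t = x))}"
  define d where "d x = (if x \<in> active then \<delta> x else 0)" for x
  have finA: "finite active" "active \<subseteq> V" using fin by (auto simp: active_def)
  have two: "2 \<le> \<delta> x" if x: "x \<in> active" for x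
  proof (cases "H \<le> \<delta> x")
    case True
    then show ?thesis using H by linarith
  next
    case False
    then obtain t where t: "t \<in> I" "nonhub t" "src t = x \<or> dst t = x" using x unfolding active_def by blast
    then show ?thesis using edge[OF t(1)] by (auto simp: nonhub_def)
  qed
  have "d x \<noteq> 0 \<longleftrightarrow> x \<in> active" for x using two[of x] by (cases "x \<in> active") (simp_all add: d_def)
  then have supp: "{x \<in> V. d x \<noteq> 0} = active" using finA by blast
  have sumV: "(\<Sum>x\<in>V. \<delta> x) = 2 * card I" unfolding \<delta>_def by (rule sum_deg_V[OF fin])
  have d\<delta>: "d x \<le> \<delta> x" for x by (simp add: d_def)
  have "(\<Sum>x\<in>V. d x) \<le> (\<Sum>x\<in>V. \<delta> x)" using d\<delta> by (rule sum_mono)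
  then have 1: "(\<Sum>x\<in>V. d x) \<le> 2 * card I" using sumV by simp
  have "2 * card active = (\<Sum>x\<in>active. 2)" by simp
  also have "\<dots> \<le> (\<Sum>x\<in>active. \<delta> x)" using two by (rule sum_mono)
  also have "\<dots> \<le> (\<Sum>x\<in>V. \<delta> x)" using finA fin by (intro sum_mono2) auto
  finally have 2: "card active \<le> card I" using sumV by simp
  have 3: "real (card active) \<le> card I / 2 + 2 * card I / D" if D: "2 \<le> D" "D \<le> H" "D\<^sup>2 \<le> Q" for D
  proof -
    define small where "small = {x \<in> active. \<delta> x < D}"
    define big where "big = {x \<in> active. D \<le> \<delta> x}"
    have fsb: "finite small" "finite big" using finA by (auto simp: small_def big_def)
    have one: "\<not> (src t \<in> small \<and> dst t \<in> small)" if t: "t \<in> I" for t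
    proof
      assume s: "src t \<in> small \<and> dst t \<in> small"
      then have lt: "\<delta> (src t) < D" "\<delta> (dst t) < D" by (auto simp: small_def)
      then have "Q \<le> real (\<delta> (src t)) * \<delta> (dst t)" using edge[OF t] D by auto
      moreover have "real (\<delta> (src t)) * \<delta> (dst t) < D * D" using lt by (intro mult_strict_mono') auto
      ultimately show False using D by (simp add: power2_eq_square)
    qed
    have "2 * card small = (\<Sum>x\<in>small. 2)" by simp
    also have "\<dots> \<le> (\<Sum>x\<in>small. \<delta> x)" using two by (intro sum_mono) (auto simp: small_def)
    also have "\<dots> = card {t \<in> I. src t \<in> small} + card {t \<in> I. dst t \<in> small}"
      unfolding \<delta>_def using fin fsb by (intro sum_deg)
    \<comment> \<open>The two sets of edges are disjoint since no edge has both ends in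
      \<open>small\<close>; this is where the factor 1/2 is gained.\<close>
    also have "\<dots> = card ({t \<in> I. src t \<in> small} \<union> {t \<in> I. dst t \<in> small})"
      using fin one by (intro card_Un_disjoint[symmetric]) auto
    also have "\<dots> \<le> card I" using fin by (intro card_mono) auto
    finally have "2 * card small \<le> card I" .
    then have s: "real (card small) \<le> card I / 2" by linarith
    have "D * card big = (\<Sum>x\<in>big. D)" by simp
    also have "\<dots> \<le> (\<Sum>x\<in>big. real (\<delta> x))" by (intro sum_mono) (auto simp: big_def)
    also have "\<dots> \<le> (\<Sum>x\<in>V. real (\<delta> x))" using finA fin by (intro sum_mono2) (auto simp: big_def)
    also have "\<dots> = 2 * card I" using sumV by (simp flip: of_nat_sum)
    finally have b: "real (card big) \<le> 2 * card I / D" using D by (simp add: field_simps)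
    have "active = small \<union> big" by (auto simp: small_def big_def)
    then have "card active \<le> card small + card big" by (simp add: card_Un_le)
    then show ?thesis using s b by linarith
  qed
  have 4: "\<forall>t\<in>I. H \<le> real (d (src t)) \<or> H \<le> real (d (dst t)) \<or> Q \<le> real (d (src t)) * real (d (dst t))"
  proof
    fix t assume t: "t \<in> I"
    then have V: "src t \<in> V" "dst t \<in> V" using fin by auto
    show "H \<le> real (d (src t)) \<or> H \<le> real (d (dst t)) \<or> Q \<le> real (d (src t)) * real (d (dst t))"
    proof (cases "nonhub t")
      case True
      then have "src t \<in> active" "dst t \<in> active" using t V by (auto simp: active_def)
      then show ?thesis using edge[OF t] True by (auto simp: d_def)
    next
      case False
      then have "H \<le> \<delta> (src t) \<or> H \<le> \<delta> (dst t)" by (auto simp: nonhub_def)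
      then show ?thesis using V by (auto simp: d_def active_def)
    qed
  qed
  show ?thesis
    by (rule that[of d]) (use 1 2 3 4 supp in auto)
qed

text \<open>The vertices from which \<open>B\<close> is reached by at most \<open>r\<close> edges of
  \<open>I\<close>, each followed from \<open>src\<close> to \<open>dst\<close>.\<close>

primrec backward_ball :: "('e \<Rightarrow> 'v) \<Rightarrow> ('e \<Rightarrow> 'v) \<Rightarrow> 'e set \<Rightarrow> 'v set \<Rightarrow> nat \<Rightarrow> 'v set" where
  "backward_ball src dst I B 0 = B"
| "backward_ball src dst I B (Suc r) =
     backward_ball src dst I B r \<union> src ` {t \<in> I. dst t \<in> backward_ball src dst I B r}"

text \<open>A vertex of degree 2 at distance \<open>r\<close> from the branch vertices accounts for only 2 of the
  degree sum, while the excess \<open>card I - card V\<close> comes from the branch vertices.\<close>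

lemma card_verts_le_of_branching:
  fixes I :: "'e set" and V :: "'v set" and src dst
  defines "\<delta> \<equiv> deg src dst I"
  defines "W \<equiv> {x \<in> V. \<delta> x \<noteq> 0}"
  assumes fin: "finite I" "finite V" "src ` I \<subseteq> V" "dst ` I \<subseteq> V"
    and two: "\<And>x. x \<in> W \<Longrightarrow> 2 \<le> \<delta> x"
    and reach: "\<And>x. x \<in> W \<Longrightarrow> x \<in> backward_ball src dst I {x \<in> V. 3 \<le> \<delta> x} r"
  shows "real (card W) \<le> (1 - 1 / 3 ^ Suc r) * card I"
proof -
  define B where "B = {x \<in> V. 3 \<le> \<delta> x}"
  define Y where "Y = backward_ball src dst I B"
  have YV: "Y k \<subseteq> V" for k
  proof (induction k)
    case 0
    show ?case by (simp add: Y_def B_def)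
  next
    case (Suc k)
    have "src ` {t \<in> I. dst t \<in> Y k} \<subseteq> V" using fin(3) by blast
    then show ?case using Suc by (simp add: Y_def)
  qed
  have finY: "finite (Y k)" for k using finite_subset[OF YV fin(2)] .
  have BY: "B \<subseteq> Y k" for k by (induction k) (auto simp: Y_def)
  \<comment> \<open>A vertex that joins the ball lies outside \<open>B\<close>, hence has degree at
    most 2, and is the source of an edge into the old ball. The number of such edges is at most the
    degree sum of the old ball, so the degree sum at most triples.\<close>
  have le: "(\<Sum>x\<in>Y k. \<delta> x) \<le> 3 ^ k * (\<Sum>x\<in>B. \<delta> x)" for k
  proof (induction k)
    case 0 then show ?case by (simp add: Y_def)
  next
    case (Suc k)
    define N where "N = Y (Suc k) - Y k"
    have N2: "\<delta> x \<le> 2" if "x \<in> N" for x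
    proof -
      have "x \<in> V" "x \<notin> B" using that BY[of k] YV[of "Suc k"] by (auto simp: N_def)
      then show ?thesis by (simp add: B_def)
    qed
    have fI: "finite {t \<in> I. dst t \<in> Y k}" using fin by simp
    have "N \<subseteq> src ` {t \<in> I. dst t \<in> Y k}" unfolding N_def Y_def backward_ball.simps by blast
    then have "card N \<le> card {t \<in> I. dst t \<in> Y k}" using surj_card_le[OF fI] by blast
    also have "\<dots> \<le> (\<Sum>x\<in>Y k. \<delta> x)" unfolding \<delta>_def using fin finY by (simp add: sum_deg)
    finally have cN: "card N \<le> (\<Sum>x\<in>Y k. \<delta> x)" .
    have un: "Y (Suc k) = Y k \<union> N" and disj: "Y k \<inter> N = {}" by (auto simp: N_def Y_def)
    have "finite N" using finY[of "Suc k"] by (simp add: N_def)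
    then have "(\<Sum>x\<in>Y (Suc k). \<delta> x) = (\<Sum>x\<in>Y k. \<delta> x) + (\<Sum>x\<in>N. \<delta> x)"
      unfolding un using finY[of k] disj by (intro sum.union_disjoint)
    also have "(\<Sum>x\<in>N. \<delta> x) \<le> (\<Sum>x\<in>N. 2)" using N2 by (rule sum_mono)
    also have "\<dots> \<le> 2 * (\<Sum>x\<in>Y k. \<delta> x)" using cN by simp
    finally show ?case using Suc by simp
  qed
  have finW: "finite W" "W \<subseteq> V" using fin by (auto simp: W_def)
  have sumW: "(\<Sum>x\<in>W. \<delta> x) = 2 * card I"
    using sum_deg_V[OF fin] fin unfolding \<delta>_def[symmetric] W_def
    by (metis (mono_tags, lifting) sum.mono_neutral_left mem_Collect_eq subsetI DiffE)
  have BW: "B \<subseteq> W" by (auto simp: B_def W_def)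
  have "2 * card I \<le> (\<Sum>x\<in>Y r. \<delta> x)"
    unfolding sumW[symmetric] using reach finY by (intro sum_mono2) (auto simp: Y_def B_def)
  also have "\<dots> \<le> 3 ^ r * (\<Sum>x\<in>B. \<delta> x)" by (rule le)
  \<comment> \<open>The inequality \<open>\<delta> x \<le> 3 * (\<delta> x - 2)\<close> holds from
    degree 3 on, so the excess over 2 controls the whole degree of a branch vertex.\<close>
  also have "(\<Sum>x\<in>B. \<delta> x) \<le> (\<Sum>x\<in>B. 3 * (\<delta> x - 2))" by (intro sum_mono) (auto simp: B_def)
  also have "\<dots> \<le> (\<Sum>x\<in>W. 3 * (\<delta> x - 2))" using BW finW by (intro sum_mono2) auto
  also have "\<dots> = 3 * (\<Sum>x\<in>W. \<delta> x - 2)" by (simp add: sum_distrib_left)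
  also have "(\<Sum>x\<in>W. \<delta> x - 2) = (\<Sum>x\<in>W. \<delta> x) - (\<Sum>x\<in>W. 2)" using two by (rule sum_subtractf_nat)
  finally have "2 * card I \<le> 3 ^ r * (3 * (2 * card I - 2 * card W))"
    using sumW by (simp add: mult.commute)
  then have *: "2 * card I \<le> 3 ^ Suc r * (2 * card I - 2 * card W)" by simp
  have "(\<Sum>x\<in>W. 2) \<le> (\<Sum>x\<in>W. \<delta> x)" using two by (rule sum_mono)
  then have "card W \<le> card I" using sumW by simp
  then have diff: "real (2 * card I - 2 * card W) = 2 * (real (card I) - card W)" by (simp add: of_nat_diff)
  have "real (2 * card I) \<le> real (3 ^ Suc r * (2 * card I - 2 * card W))"
    using * by (simp only: of_nat_le_iff)
  then have "2 * real (card I) \<le> 2 * (3 ^ Suc r * (real (card I) - card W))"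
    unfolding of_nat_mult diff by (simp add: algebra_simps)
  then have "real (card I) \<le> 3 ^ Suc r * (real (card I) - card W)" by simp
  then have "real (card I) / 3 ^ Suc r \<le> real (card I) - card W" by (subst pos_divide_le_eq) (simp_all add: mult.commute)
  then show ?thesis by (simp add: algebra_simps)
qed

section \<open>Expected numbers of cycles\<close>

type_synonym slot = "nat \<times> nat \<times> nat"

text \<open>The slot \<open>(i, a, b)\<close> stands for the pair of the vertices \<open>(i, a)\<close> and \<open>(i + 1 mod l, b)\<close>.\<close>

definition slots :: "nat \<Rightarrow> nat \<Rightarrow> slot set" where
  "slots l n = {..<l} \<times> {..<n} \<times> {..<n}"

definition slot_src :: "slot \<Rightarrow> nat \<times> nat" where
  "slot_src t = (fst t, fst (snd t))"

definition slot_dst :: "nat \<Rightarrow> slot \<Rightarrow> nat \<times> nat" where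
  "slot_dst l t = (Suc (fst t) mod l, snd (snd t))"

definition cycle_slots :: "nat \<Rightarrow> (nat \<Rightarrow> nat) \<Rightarrow> slot set" where
  "cycle_slots l c = (\<lambda>i. (i, c i, c (Suc i mod l))) ` {..<l}"

text \<open>Reducing \<open>i\<close> modulo \<open>l\<close> makes the matrices periodic. For
  \<open>p = 0\<close> their products count the walks inside \<open>U\<close>.\<close>

definition wt :: "nat \<Rightarrow> real \<Rightarrow> slot set \<Rightarrow> nat \<Rightarrow> nat \<Rightarrow> nat \<Rightarrow> real" where
  "wt l p U i a b = (if (i mod l, a, b) \<in> U then 1 else p)"

text \<open>The conditional expectation of the number of cycles given that all slots in \<open>U\<close> are edges.\<close>

definition expected_cycles :: "nat \<Rightarrow> nat \<Rightarrow> real \<Rightarrow> slot set \<Rightarrow> real" where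
  "expected_cycles l n p U = (\<Sum>c\<in>PiE {..<l} (\<lambda>_. {..<n}). p ^ card (cycle_slots l c - U))"

lemma finite_slots [simp]: "finite (slots l n)"
  by (simp add: slots_def)

text \<open>The slots of a closed walk lie in different classes, so the power of \<open>p\<close> is
  a product of one weight per class. The starting class \<open>j\<close> is free by cyclic
  invariance.\<close>

lemma expected_cycles_eq_trace:
  assumes "0 < l"
  shows "expected_cycles l n p U = (\<Sum>a<n. mprod n (wt l p U) j l a a)"
proof -
  have "p ^ card (cycle_slots l c - U) = (\<Prod>i<l. wt l p U i (c i) (c (Suc i mod l)))" for c
  proof -
    define J where "J = {i\<in>{..<l}. (i, c i, c (Suc i mod l)) \<notin> U}"
    have "cycle_slots l c - U = (\<lambda>i. (i, c i, c (Suc i mod l))) ` J"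
      by (auto simp: cycle_slots_def J_def)
    moreover have "card ((\<lambda>i. (i, c i, c (Suc i mod l))) ` J) = card J"
      by (intro card_image) (auto simp: inj_on_def)
    ultimately have "p ^ card (cycle_slots l c - U) = (\<Prod>i\<in>J. p)"
      by (simp only: prod_constant)
    also have "\<dots> = (\<Prod>i<l. wt l p U i (c i) (c (Suc i mod l)))"
      by (rule prod.mono_neutral_cong_left) (auto simp: wt_def J_def)
    finally show ?thesis .
  qed
  then have "expected_cycles l n p U = (\<Sum>a<n. mprod n (wt l p U) 0 l a a)"
    unfolding expected_cycles_def using sum_closed_walks_eq_trace[OF assms, where f = "wt l p U"] by simp
  also have "\<dots> = (\<Sum>a<n. mprod n (wt l p U) j l a a)"
    by (rule mprod_trace_rotate[symmetric]) (simp add: wt_def fun_eq_iff)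
  finally show ?thesis .
qed

lemma expected_cycles_empty:
  assumes "0 < l"
  shows "expected_cycles l n p {} = (real n * p) ^ l"
proof -
  have "card (cycle_slots l c) = l" for c
    unfolding cycle_slots_def by (subst card_image) (auto simp: inj_on_def)
  then show ?thesis by (simp add: expected_cycles_def card_PiE power_mult_distrib)
qed

lemma sum_indicator_slots_le:
  fixes U :: "slot set"
  assumes "finite U"
  shows "(\<Sum>a<n. \<Sum>b<n. if (i, a, b) \<in> U then 1 else 0) \<le> real (card U)"
proof -
  have "(\<Sum>a<n. \<Sum>b<n. if (i, a, b) \<in> U then 1 else 0 :: real)
      = (\<Sum>(a, b)\<in>{..<n} \<times> {..<n}. if (i, a, b) \<in> U then 1 else 0)"
    by (rule sum.cartesian_product)
  also have "\<dots> = (\<Sum>z\<in>{..<n} \<times> {..<n}. if (i, z) \<in> U then 1 else 0)"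
    by (intro sum.cong refl) auto
  also have "\<dots> = (\<Sum>z\<in>{z \<in> {..<n} \<times> {..<n}. (i, z) \<in> U}. 1)"
    by (rule sum.inter_filter[symmetric]) simp
  also have "\<dots> = real (card {z \<in> {..<n} \<times> {..<n}. (i, z) \<in> U})" by simp
  also have "card {z \<in> {..<n} \<times> {..<n}. (i, z) \<in> U} = card ((\<lambda>z. (i, z)) ` {z \<in> {..<n} \<times> {..<n}. (i, z) \<in> U})"
    by (intro card_image[symmetric]) (auto simp: inj_on_def)
  also have "real \<dots> \<le> real (card U)" using assms by (intro of_nat_mono card_mono) auto
  finally show ?thesis .
qed

lemma wt_square_le: "(wt l p U i a b)\<^sup>2 \<le> p\<^sup>2 + (if (i mod l, a, b) \<in> U then 1 else 0)"
  by (simp add: wt_def)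

lemma wt_sum_squares_le:
  assumes "finite U"
  shows "(\<Sum>a<n. \<Sum>b<n. (wt l p U i a b)\<^sup>2) \<le> (real n * p)\<^sup>2 + card U"
proof -
  have "(\<Sum>a<n. \<Sum>b<n. (wt l p U i a b)\<^sup>2)
      \<le> (\<Sum>a<n. \<Sum>b<n. p\<^sup>2 + (if (i mod l, a, b) \<in> U then 1 else 0))"
    by (intro sum_mono wt_square_le)
  also have "\<dots> = (real n * p)\<^sup>2 + (\<Sum>a<n. \<Sum>b<n. if (i mod l, a, b) \<in> U then 1 else 0)"
    by (simp add: sum.distrib power2_eq_square mult_ac)
  also have "\<dots> \<le> (real n * p)\<^sup>2 + card U" using sum_indicator_slots_le[OF assms] by simp
  finally show ?thesis .
qed

lemma expected_cycles_square_le: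
  assumes "finite U" "2 \<le> l"
  shows "(expected_cycles l n p U)\<^sup>2 \<le> ((real n * p)\<^sup>2 + card U) ^ l"
proof -
  have "0 < l" using assms(2) by simp
  then show ?thesis
    unfolding expected_cycles_eq_trace[where j = 0, OF \<open>0 < l\<close>]
    by (intro mprod_trace_square_le wt_sum_squares_le assms)
qed

text \<open>With the trace rotated to start in class \<open>j\<close>, the slot occurs only in the
  first factor, because the other \<open>l - 1\<close> factors belong to other classes. Its deletion
  lowers one entry from 1 to \<open>p\<close>, and the factor \<open>1 - p\<close> is dropped. What
  remains is the weight of the walks of length \<open>l - 1\<close> from the head of the edge back
  to its tail.\<close>

lemma expected_cycles_remove_le:
  assumes t: "(j, x, y) \<in> U" "(j, x, y) \<in> slots l n" and p: "0 \<le> p" "p \<le> 1"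
  shows "expected_cycles l n p U - expected_cycles l n p (U - {(j, x, y)})
         \<le> mprod n (wt l p U) (Suc j) (l - 1) y x"
proof -
  define U' where "U' = U - {(j, x, y)}"
  have j: "j < l" "x < n" "y < n" using t by (auto simp: slots_def)
  then obtain r where l: "l = Suc r" by (cases l) auto
  have eq: "mprod n (wt l p U') (Suc j) r v a = mprod n (wt l p U) (Suc j) r v a" if "v < n" for v a
  proof (rule mprod_cong[OF _ that])
    fix k a b assume k: "Suc j \<le> k" "k < Suc j + r"
    have "k mod l \<noteq> j"
    proof
      assume "k mod l = j"
      then have "l dvd k - j" using k by (metis dvd_minus_mod)
      then have "l \<le> k - j" using k by (intro dvd_imp_le) auto
      then show False using k l by simp
    qed
    then show "wt l p U' k a b = wt l p U k a b" by (simp add: wt_def U'_def)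
  qed
  have tr: "expected_cycles l n p S = (\<Sum>a<n. \<Sum>v<n. wt l p S j a v * mprod n (wt l p S) (Suc j) r v a)" for S
    using j expected_cycles_eq_trace[of l n p S j] by (simp add: l)
  have "expected_cycles l n p U - expected_cycles l n p U'
      = (\<Sum>a<n. \<Sum>v<n. (wt l p U j a v - wt l p U' j a v) * mprod n (wt l p U) (Suc j) r v a)"
    unfolding tr by (simp add: sum_subtractf[symmetric] eq left_diff_distrib)
  also have "\<dots> = (\<Sum>a<n. \<Sum>v<n. if v = y then if a = x then (1 - p) * mprod n (wt l p U) (Suc j) r y x else 0 else 0)"
    using j t by (intro sum.cong refl) (auto simp: wt_def U'_def)
  also have "\<dots> = (1 - p) * mprod n (wt l p U) (Suc j) r y x"
    using j by simp
  also have "\<dots> \<le> mprod n (wt l p U) (Suc j) r y x"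
    using p mprod_nonneg[of "wt l p U" n "Suc j" r y x] by (simp add: wt_def mult_left_le_one_le)
  finally show ?thesis by (simp add: U'_def l)
qed

lemma card_out_slots:
  assumes "U \<subseteq> slots l n"
  shows "(\<Sum>b<n. if (i, a, b) \<in> U then 1 else 0) = real (card {t \<in> U. slot_src t = (i, a)})"
proof -
  have "{t \<in> U. slot_src t = (i, a)} = (\<lambda>b. (i, a, b)) ` {b \<in> {..<n}. (i, a, b) \<in> U}"
    using assms by (force simp: slot_src_def slots_def)
  also have "card \<dots> = card {b \<in> {..<n}. (i, a, b) \<in> U}"
    by (intro card_image) (auto simp: inj_on_def)
  finally show ?thesis by (simp add: sum.If_cases Int_def)
qed

lemma card_in_slots:
  assumes "U \<subseteq> slots l n" "i < l"
  shows "(\<Sum>a<n. if (i, a, b) \<in> U then 1 else 0) = real (card {t \<in> U. slot_dst l t = (Suc i mod l, b)})"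
proof -
  have inj: "k = i" if "k < l" "Suc k mod l = Suc i mod l" for k
    using that assms(2) by (auto simp: mod_Suc split: if_splits)
  have "{t \<in> U. slot_dst l t = (Suc i mod l, b)} = (\<lambda>a. (i, a, b)) ` {a \<in> {..<n}. (i, a, b) \<in> U}"
    using assms(1) inj by (force simp: slot_dst_def slots_def)
  also have "card \<dots> = card {a \<in> {..<n}. (i, a, b) \<in> U}"
    by (intro card_image) (auto simp: inj_on_def)
  finally show ?thesis by (simp add: sum.If_cases Int_def)
qed

text \<open>In the entry bound for matrix products, the row yields the out-degree of the head of the
  edge, the column the in-degree of its tail, and the \<open>l - 3\<close> factors in between the
  Hilbert-Schmidt bound.\<close>

lemma connecting_walks_square_le:
  assumes U: "U \<subseteq> slots l n" and t: "(j, x, y) \<in> U" and l: "3 \<le> l"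
  shows "(mprod n (wt l p U) (Suc j) (l - 1) y x)\<^sup>2
    \<le> (real n * p\<^sup>2 + card {t \<in> U. slot_src t = slot_dst l (j, x, y)}) * ((real n * p)\<^sup>2 + card U) ^ (l - 3)
      * (real n * p\<^sup>2 + card {t \<in> U. slot_dst l t = slot_src (j, x, y)})"
proof -
  obtain r where "l = 3 + r" using l le_Suc_ex by blast
  then have lr: "l = Suc (Suc (Suc r))" by simp
  have j: "j < l" "x < n" "y < n" using U t by (auto simp: slots_def)
  have finU: "finite U" using U finite_subset[OF _ finite_slots] by blast
  \<comment> \<open>The class of the last step of such a walk, the cyclic predecessor of
    \<open>j\<close>.\<close>
  define q where "q = (j + Suc (Suc r)) mod l"
  have q: "q < l" unfolding q_def using j by (intro mod_less_divisor) linarith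
  have Sq: "Suc q mod l = j" 
  proof -
    have "Suc q mod l = (j + l) mod l" unfolding q_def mod_Suc_eq by (simp add: lr)
    then show ?thesis using j by simp
  qed
  have row: "(\<Sum>v<n. (wt l p U (Suc j) y v)\<^sup>2) \<le> real n * p\<^sup>2 + card {t \<in> U. slot_src t = slot_dst l (j, x, y)}"
  proof -
    have "(\<Sum>v<n. (wt l p U (Suc j) y v)\<^sup>2) \<le> (\<Sum>v<n. p\<^sup>2 + (if (Suc j mod l, y, v) \<in> U then 1 else 0))"
      by (intro sum_mono wt_square_le)
    then show ?thesis
      using card_out_slots[OF U, of "Suc j mod l" y] by (simp add: sum.distrib slot_dst_def)
  qed
  have col: "(\<Sum>v<n. (wt l p U (Suc j + Suc r) v x)\<^sup>2) \<le> real n * p\<^sup>2 + card {t \<in> U. slot_dst l t = slot_src (j, x, y)}"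
  proof -
    have "(\<Sum>v<n. (wt l p U (Suc j + Suc r) v x)\<^sup>2) \<le> (\<Sum>v<n. p\<^sup>2 + (if (q, v, x) \<in> U then 1 else 0))"
      using wt_square_le[of l p U "Suc j + Suc r"] by (intro sum_mono) (simp add: q_def)
    then show ?thesis
      using card_in_slots[OF U q, of x] Sq by (simp add: sum.distrib slot_src_def)
  qed
  have "(mprod n (wt l p U) (Suc j) (Suc (Suc r)) y x)\<^sup>2
      \<le> (\<Sum>v<n. (wt l p U (Suc j) y v)\<^sup>2) * ((real n * p)\<^sup>2 + card U) ^ r * (\<Sum>v<n. (wt l p U (Suc j + Suc r) v x)\<^sup>2)"
    using j by (intro mprod_entry_square_le wt_sum_squares_le finU) auto
  also have "\<dots> \<le> (real n * p\<^sup>2 + card {t \<in> U. slot_src t = slot_dst l (j, x, y)}) * ((real n * p)\<^sup>2 + card U) ^ r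
      * (real n * p\<^sup>2 + card {t \<in> U. slot_dst l t = slot_src (j, x, y)})"
    using row col by (intro mult_mono mult_nonneg_nonneg sum_nonneg) auto
  finally show ?thesis by (simp add: lr del: mprod.simps)
qed

text \<open>With \<open>p\<close> replaced by 0 only walks inside \<open>U\<close> count. The error
  is harmless when \<open>n * p\<close> and \<open>card U\<close> are bounded by powers of
  \<open>ln (1/p)\<close>, as they are in the sparse regime.\<close>

lemma connecting_walks_le_count:
  assumes U: "U \<subseteq> slots l n" "U \<noteq> {}" and p: "0 \<le> p" and ab: "a < n" "b < n"
  shows "mprod n (wt l p U) i r a b \<le> mprod n (wt l 0 U) i r a b + real r * p * (real n * p + card U) ^ r"
proof -
  have finU: "finite U" using U finite_subset[OF _ finite_slots] by blast
  then have c1: "1 \<le> real (card U)" using U(2) by (simp add: Suc_le_eq card_gt_0_iff)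
  have wt: "wt l p U k a b \<le> p + (if (k mod l, a, b) \<in> U then 1 else 0)" for k a b
    using p by (simp add: wt_def)
  have l0: "0 < l" using U by (auto simp: slots_def)
  have out: "(\<Sum>b<n. if (k mod l, a, b) \<in> U then 1 else 0) \<le> real (card U)" for k a
    unfolding card_out_slots[OF U(1)] using finU by (intro of_nat_mono card_mono) auto
  have col: "(\<Sum>a<n. if (k mod l, a, b) \<in> U then 1 else 0) \<le> real (card U)" for k b
    using l0 finU by (subst card_in_slots[OF U(1)]) (auto intro!: of_nat_mono card_mono)
  show ?thesis
  proof (rule mprod_perturb_le)
    fix k a
    show "(\<Sum>b<n. wt l 0 U k a b) \<le> real n * p + card U"
      using out[of k a] p by (simp add: wt_def) (smt (verit) mult_nonneg_nonneg of_nat_0_le_iff)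
  next
    fix k b
    have "(\<Sum>a<n. wt l p U k a b) \<le> (\<Sum>a<n. p + (if (k mod l, a, b) \<in> U then 1 else 0))"
      by (intro sum_mono wt)
    then show "(\<Sum>a<n. wt l p U k a b) \<le> real n * p + card U"
      using col[of k b] by (simp add: sum.distrib)
  qed (use p ab c1 in \<open>auto simp: wt_def intro: add_increasing\<close>)
qed

text \<open>With more than one continuation, the walks from \<open>(i, a)\<close> cannot all follow forced steps.\<close>

lemma reaches_branching:
  fixes U :: "slot set" and l :: nat
  defines "\<delta> \<equiv> deg slot_src (slot_dst l) U"
  assumes U: "U \<subseteq> slots l n" and gt: "1 < mprod n (wt l 0 U) i r a b"
    and "a < n" "b < n" and into: "\<exists>t\<in>U. slot_dst l t = (i mod l, a)"
  shows "(i mod l, a) \<in> backward_ball slot_src (slot_dst l) U {x \<in> {..<l} \<times> {..<n}. 3 \<le> \<delta> x} r"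
  using gt \<open>a < n\<close> into
proof (induction r arbitrary: i a)
  case 0
  then show ?case by (simp split: if_splits)
next
  case (Suc r)
  define x where "x = (i mod l, a)"
  have finU: "finite U" using U finite_subset[OF _ finite_slots] by blast
  have l0: "0 < l" using Suc.prems(3) U by (auto simp: slots_def)
  have xV: "x \<in> {..<l} \<times> {..<n}" using Suc.prems l0 by (simp add: x_def)
  have in1: "1 \<le> card {t \<in> U. slot_dst l t = x}"
    using Suc.prems(3) finU by (auto simp: x_def Suc_le_eq card_gt_0_iff)
  show ?case
  proof (cases "2 \<le> card {t \<in> U. slot_src t = x}")
    case True
    have sub: "{x \<in> {..<l} \<times> {..<n}. 3 \<le> \<delta> x} \<subseteq> backward_ball slot_src (slot_dst l) U {x \<in> {..<l} \<times> {..<n}. 3 \<le> \<delta> x} k" for k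
      by (induction k) auto
    have "3 \<le> \<delta> x" using True in1 by (simp add: \<delta>_def deg_def)
    then show ?thesis using xV sub[of "Suc r"] by (auto simp: x_def)
  next
    case False
    \<comment> \<open>Now exactly one edge leaves \<open>x\<close>. This forced step does not change
      the number of walks, so the induction hypothesis applies at its end, which the same edge
      enters.\<close>
    have "(\<Sum>v<n. wt l 0 U i a v * mprod n (wt l 0 U) (Suc i) r v b) \<noteq> 0" using Suc.prems by simp
    then obtain v where v: "v < n" "wt l 0 U i a v \<noteq> 0"
      by (metis (no_types, lifting) lessThan_iff mult_zero_left sum.neutral)
    then have vU: "(i mod l, a, v) \<in> U" by (auto simp: wt_def split: if_splits)
    have uniq: "w = v" if "(i mod l, a, w) \<in> U" for w
    proof (rule ccontr)
      assume "w \<noteq> v"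
      then have "card {(i mod l, a, v), (i mod l, a, w)} = 2" by simp
      moreover have "card {(i mod l, a, v), (i mod l, a, w)} \<le> card {t \<in> U. slot_src t = x}"
        using that vU finU by (intro card_mono) (auto simp: slot_src_def x_def)
      ultimately show False using False by simp
    qed
    have "wt l 0 U i a w = (if w = v then 1 else 0)" for w
    proof (cases "w = v")
      case True
      then show ?thesis using vU by (simp add: wt_def)
    next
      case False
      then have "(i mod l, a, w) \<notin> U" using uniq by blast
      then show ?thesis using False by (simp add: wt_def)
    qed
    then have "mprod n (wt l 0 U) i (Suc r) a b = mprod n (wt l 0 U) (Suc i) r v b"
      using v by (simp add: if_distrib[of "\<lambda>x. x * _"] cong: if_cong)
    then have "1 < mprod n (wt l 0 U) (Suc i) r v b" using Suc.prems by simp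
    moreover have dst: "slot_dst l (i mod l, a, v) = (Suc i mod l, v)" by (simp add: slot_dst_def mod_Suc_eq)
    ultimately have "(Suc i mod l, v) \<in> backward_ball slot_src (slot_dst l) U {x \<in> {..<l} \<times> {..<n}. 3 \<le> \<delta> x} r"
      using vU v by (intro Suc.IH) auto
    then have "slot_src (i mod l, a, v) \<in> backward_ball slot_src (slot_dst l) U {x \<in> {..<l} \<times> {..<n}. 3 \<le> \<delta> x} (Suc r)"
      using vU dst by (metis (mono_tags, lifting) UnI2 backward_ball.simps(2) imageI mem_Collect_eq)
    moreover have "slot_src (i mod l, a, v) = (i mod l, a)" by (simp add: slot_src_def)
    ultimately show ?thesis by (simp only:)
  qed
qed

text \<open>A walk from the head of each edge to its tail gives every used vertex an edge in and an
  edge out, hence degree at least 2. A second walk forces a branch vertex within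
  \<open>l - 1\<close> steps of the head, and every used vertex is the head of some edge.\<close>

lemma card_verts_le_of_connecting_walks:
  fixes U :: "slot set" and l :: nat
  defines "\<delta> \<equiv> deg slot_src (slot_dst l) U"
  assumes U: "U \<subseteq> slots l n" and l: "2 \<le> l"
    and gt: "\<And>j x y. (j, x, y) \<in> U \<Longrightarrow> 1 < mprod n (wt l 0 U) (Suc j) (l - 1) y x"
  shows "real (card {x \<in> {..<l} \<times> {..<n}. \<delta> x \<noteq> 0}) \<le> (1 - 1 / 3 ^ l) * card U"
proof -
  obtain r where "l = 2 + r" using l le_Suc_ex by blast
  then have lr: "l = Suc (Suc r)" by simp
  have finU: "finite U" using U finite_subset[OF _ finite_slots] by blast
  have pred: "\<exists>t'\<in>U. slot_dst l t' = slot_src t" and succ: "\<exists>t'\<in>U. slot_src t' = slot_dst l t"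
    if "t \<in> U" for t
  proof -
    obtain j x y where t: "t = (j, x, y)" by (cases t)
    have j: "j < l" "x < n" "y < n" using U that by (auto simp: slots_def t)
    have gt': "1 < mprod n (wt l 0 U) (Suc j) (Suc r) y x" using gt that by (simp add: t lr)
    have "(\<Sum>v<n. wt l 0 U (Suc j) y v * mprod n (wt l 0 U) (Suc (Suc j)) r v x) \<noteq> 0" using gt' by simp
    then obtain v where "v < n" "wt l 0 U (Suc j) y v \<noteq> 0"
      by (metis (no_types, lifting) lessThan_iff mult_zero_left sum.neutral)
    then have "(Suc j mod l, y, v) \<in> U" by (auto simp: wt_def split: if_splits)
    then show "\<exists>t'\<in>U. slot_src t' = slot_dst l t" by (force simp: t slot_src_def slot_dst_def)
    have "(\<Sum>v<n. mprod n (wt l 0 U) (Suc j) r y v * wt l 0 U (Suc j + r) v x) \<noteq> 0"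
      using gt' j by (simp only: mprod_Suc_right)
    then obtain v where "v < n" "wt l 0 U (Suc j + r) v x \<noteq> 0"
      by (metis (no_types, lifting) lessThan_iff mult_zero_right sum.neutral)
    then have "((Suc j + r) mod l, v, x) \<in> U" by (auto simp: wt_def split: if_splits)
    moreover have "Suc ((Suc j + r) mod l) mod l = j"
    proof -
      have "Suc ((Suc j + r) mod l) mod l = (j + l) mod l" unfolding mod_Suc_eq by (simp add: lr)
      then show ?thesis using j by simp
    qed
    ultimately show "\<exists>t'\<in>U. slot_dst l t' = slot_src t" by (force simp: t slot_src_def slot_dst_def)
  qed
  have sub: "slot_src ` U \<subseteq> {..<l} \<times> {..<n}" "slot_dst l ` U \<subseteq> {..<l} \<times> {..<n}"
    using U by (auto simp: slots_def slot_src_def slot_dst_def)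
  have inout: "(\<exists>t\<in>U. slot_src t = x) \<and> (\<exists>t\<in>U. slot_dst l t = x)" if "\<delta> x \<noteq> 0" for x
  proof -
    have "{t \<in> U. slot_src t = x} \<noteq> {} \<or> {t \<in> U. slot_dst l t = x} \<noteq> {}"
      using that unfolding \<delta>_def deg_def by (metis add_is_0 card.empty)
    then show ?thesis using pred succ by blast
  qed
  have "real (card {x \<in> {..<l} \<times> {..<n}. \<delta> x \<noteq> 0}) \<le> (1 - 1 / 3 ^ Suc (Suc r)) * card U"
    unfolding \<delta>_def
  proof (rule card_verts_le_of_branching)
    fix x assume x: "x \<in> {x \<in> {..<l} \<times> {..<n}. deg slot_src (slot_dst l) U x \<noteq> 0}"
    then have io: "(\<exists>t\<in>U. slot_src t = x) \<and> (\<exists>t\<in>U. slot_dst l t = x)" using inout by (simp add: \<delta>_def)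
    then have "{t \<in> U. slot_src t = x} \<noteq> {}" "{t \<in> U. slot_dst l t = x} \<noteq> {}" by blast+
    then have "0 < card {t \<in> U. slot_src t = x}" "0 < card {t \<in> U. slot_dst l t = x}"
      using finU by (simp_all only: card_gt_0_iff finite_Collect_conjI Collect_mem_eq simp_thms)
    then show "2 \<le> deg slot_src (slot_dst l) U x" by (simp add: deg_def)
    obtain j w y where t: "(j, w, y) \<in> U" "slot_dst l (j, w, y) = x" using io by (metis prod_cases3)
    have xeq: "x = (Suc j mod l, y)" using t by (simp add: slot_dst_def)
    have j: "w < n" "y < n" using U t by (auto simp: slots_def)
    show "x \<in> backward_ball slot_src (slot_dst l) U
        {x \<in> {..<l} \<times> {..<n}. 3 \<le> deg slot_src (slot_dst l) U x} (Suc r)"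
      unfolding xeq by (rule reaches_branching[OF U, where b = w]) (use gt[OF t(1)] t xeq j in \<open>auto simp: lr\<close>)
  qed (use finU sub in auto)
  then show ?thesis by (simp add: lr)
qed

section \<open>Counting cores\<close>

lemma card_fibre_pos: "finite I \<Longrightarrow> t \<in> I \<Longrightarrow> 0 < card {t' \<in> I. g t' = g t}"
  by (auto simp: card_gt_0_iff)

text \<open>The union bound for a single size \<open>s\<close>, with the losses per edge separated:
  \<open>\<zeta>\<close> for naming the vertices of nonzero advice, \<open>\<beta>\<close> for
  placing the edges once the advice is known. The condition \<open>zn\<close> reduces the
  exponential factor of \<open>card_edge_sets_le\<close> to \<open>exp 1 ^ s\<close>.\<close>

lemma slots_family_bound:
  fixes \<I> :: "slot set set" and p z v \<zeta> \<beta> H Q :: real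
  assumes l: "0 < l" and HQ: "0 < H" "0 < Q" and z: "0 < z" "z \<le> 1" and s: "0 < s"
    and \<I>: "\<And>I. I \<in> \<I> \<Longrightarrow> I \<subseteq> slots l n" "\<And>I. I \<in> \<I> \<Longrightarrow> card I = s"
    and advice: "\<And>I. I \<in> \<I> \<Longrightarrow> \<exists>d. (\<Sum>x\<in>{..<l} \<times> {..<n}. d x) \<le> 2 * s \<and>
        real (card {x \<in> {..<l} \<times> {..<n}. d x \<noteq> 0}) \<le> v \<and>
        (\<forall>t\<in>I. H \<le> real (d (slot_src t)) \<or> H \<le> real (d (slot_dst l t)) \<or>
           Q \<le> real (d (slot_src t)) * real (d (slot_dst l t)))"
    and p: "0 \<le> p"
    and \<zeta>: "(1 / z) powr v \<le> \<zeta> ^ s" and zn: "z * (real l * real n) \<le> s"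
    and \<beta>: "exp 1 * (4 * real n / H + 4 * real s / Q) \<le> \<beta>"
  shows "real (card \<I>) * p ^ s \<le> (4 * \<zeta> * exp 1 * \<beta> * p) ^ s"
proof -
  have \<beta>0: "0 \<le> \<beta>" using \<beta> HQ by (smt (verit) divide_nonneg_pos exp_gt_zero mult_nonneg_nonneg of_nat_0_le_iff)
  have \<zeta>s: "0 \<le> \<zeta> ^ s" using \<zeta> by (rule order_trans[OF powr_ge_zero])
  have "real (card \<I>) \<le> 4 ^ s * (1 / z) powr v * exp (z * card ({..<l} \<times> {..<n}))
      * (exp 1 * (4 * real n / H + 4 * real s / Q)) ^ s"
  proof (rule card_edge_sets_le[where T = "slots l n" and src = slot_src and dst = "slot_dst l" and n = n])
    show "slot_src ` slots l n \<subseteq> {..<l} \<times> {..<n}" "slot_dst l ` slots l n \<subseteq> {..<l} \<times> {..<n}"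
      using l by (auto simp: slots_def slot_src_def slot_dst_def)
    show "inj_on (\<lambda>t. (slot_src t, slot_dst l t)) (slots l n)"
      by (auto simp: inj_on_def slots_def slot_src_def slot_dst_def)
    fix x assume x: "x \<in> {..<l} \<times> {..<n}"
    have sub: "{t \<in> slots l n. slot_src t = x} \<subseteq> (\<lambda>b. (fst x, snd x, b)) ` {..<n}"
      by (auto simp: slots_def slot_src_def image_iff)
    show "card {t \<in> slots l n. slot_src t = x} \<le> n"
      using surj_card_le[OF finite_lessThan sub] by simp
    obtain i where i: "i < l" "Suc i mod l = fst x"
    proof (cases "fst x")
      case 0
      then show ?thesis using l that[of "l - 1"] by simp
    next
      case (Suc k)
      then show ?thesis using x that[of k] by auto
    qed
    have inj: "k = i" if "k < l" "Suc k mod l = Suc i mod l" for k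
      using that i by (auto simp: mod_Suc split: if_splits)
    have sub: "{t \<in> slots l n. slot_dst l t = x} \<subseteq> (\<lambda>a. (i, a, snd x)) ` {..<n}"
    proof
      fix t assume t: "t \<in> {t \<in> slots l n. slot_dst l t = x}"
      obtain k a b where tk: "t = (k, a, b)" by (cases t)
      have "k < l" "a < n" "Suc k mod l = fst x" "b = snd x" using t by (auto simp: tk slots_def slot_dst_def)
      then show "t \<in> (\<lambda>a. (i, a, snd x)) ` {..<n}" using inj[of k] i by (simp add: tk)
    qed
    show "card {t \<in> slots l n. slot_dst l t = x} \<le> n"
      using surj_card_le[OF finite_lessThan sub] by simp
  qed (use assms in auto)
  also have "\<dots> \<le> 4 ^ s * \<zeta> ^ s * exp 1 ^ s * \<beta> ^ s"
  proof (intro mult_mono power_mono)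
    show "exp (z * card ({..<l} \<times> {..<n})) \<le> exp 1 ^ s"
    proof -
      have "exp (z * card ({..<l} \<times> {..<n})) \<le> exp (real s)"
        using zn by (simp add: card_cartesian_product)
      also have "\<dots> = exp 1 ^ s" using exp_of_nat_mult[of s "1::real"] by simp
      finally show ?thesis .
    qed
  qed (use \<zeta> \<zeta>s \<beta> \<beta>0 HQ in \<open>auto intro!: mult_nonneg_nonneg\<close>)
  finally have "real (card \<I>) * p ^ s \<le> (4 ^ s * \<zeta> ^ s * exp 1 ^ s * \<beta> ^ s) * p ^ s"
    using p by (intro mult_right_mono) auto
  then show ?thesis by (simp add: power_mult_distrib)
qed

text \<open>When the product is expanded, the terms that contain \<open>a\<close> use up at most 1/4
  + 1/8 + 1/8 of the lower bound, so \<open>u * w\<close> keeps half of it.\<close>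

lemma hub_dichotomy:
  fixes a n c Y u w :: real
  assumes "0 \<le> a" "0 \<le> u" "0 \<le> w" "0 < Y" "0 \<le> c"
    and "c * (a * n) / Y \<le> (a + u) * (a + w)" "a \<le> c * n / (4 * Y)"
    and "u \<le> c * n / (8 * Y)" "w \<le> c * n / (8 * Y)"
  shows "c * (a * n) / (2 * Y) \<le> u * w"
proof -
  define E where "E = c * (a * n) / Y"
  have "a * a \<le> a * (c * n / (4 * Y))" "a * u \<le> a * (c * n / (8 * Y))" "a * w \<le> a * (c * n / (8 * Y))"
    using assms by (intro mult_left_mono; simp)+
  moreover have "a * (c * n / (8 * Y)) = E / 8" "a * (c * n / (4 * Y)) = E / 4"
    by (simp_all add: E_def field_simps)
  ultimately have "a * a \<le> E / 4" "a * u \<le> E / 8" "a * w \<le> E / 8" by simp_all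
  moreover have "E \<le> a * a + a * u + a * w + u * w" using assms(6) by (simp add: E_def algebra_simps)
  ultimately have "E / 2 \<le> u * w" by linarith
  then show ?thesis by (simp add: E_def field_simps)
qed

text \<open>A core with \<open>s \<le> (n p)^2 L\<close> edges falls under \<open>dense_bound\<close> if \<open>p \<ge> n^(-2/3)\<close>, under
  \<open>middle_bound\<close> if \<open>p\<close> is smaller but \<open>n p\<close> exceeds a power of \<open>L\<close>, and under \<open>sparse_bound\<close>
  otherwise; the regimes differ in the bound for the number of vertices.\<close>

locale core_family =
  fixes l n s :: nat and p \<delta> \<theta> L :: real and \<I> :: "slot set set"
  assumes l: "3 \<le> l" and \<delta>: "0 < \<delta>" and p: "0 < p" "p \<le> 1" and q1: "1 \<le> real n * p"
    and s: "0 < s" and L1: "1 \<le> L" and sL: "real s \<le> (real n * p)\<^sup>2 * L"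
    and \<theta>: "\<delta> * (real n * p) ^ (l - 2) / (4 * L) \<le> \<theta>"
    and \<I>: "\<And>I. I \<in> \<I> \<Longrightarrow> I \<subseteq> slots l n" "\<And>I. I \<in> \<I> \<Longrightarrow> card I = s"
    and core: "\<And>I t. I \<in> \<I> \<Longrightarrow> t \<in> I \<Longrightarrow>
        \<theta> \<le> expected_cycles l n p I - expected_cycles l n p (I - {t})"
begin

text \<open>The constant results from dividing the square of the lower bound for
  \<open>\<theta>\<close> by \<open>(2 * L * (n * p)^2)^(l - 3)\<close>: the 16 from
  \<open>4 * L\<close> and the factor \<open>2^(l - 3)\<close> give \<open>2^(l + 1)\<close>. The
  divisors 8 in \<open>H\<close> and 2 in \<open>Q\<close> are those of
  \<open>hub_dichotomy\<close>.\<close>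

definition c where "c = \<delta>\<^sup>2 / 2 ^ (l + 1)"
definition H where "H = c * real n / (8 * L ^ (l - 1))"
definition Q where "Q = c * (real n * p)\<^sup>2 / (2 * L ^ (l - 1))"

lemma n0: "0 < n" using q1 p by (cases n) auto

lemma c0: "0 < c" using \<delta> by (simp add: c_def)

lemma Y0: "0 < L ^ (l - 1)" using L1 by simp

lemma H0: "0 < H" using c0 Y0 n0 by (simp add: H_def)

lemma Q0: "0 < Q" using c0 Y0 q1 n0 p by (simp add: Q_def)

lemma connecting_walks_ge:
  assumes "I \<in> \<I>" "(j, x, y) \<in> I"
  shows "\<theta> \<le> mprod n (wt l p I) (Suc j) (l - 1) y x"
  using core[OF assms] expected_cycles_remove_le[of j x y I l n p] \<I>(1)[OF assms(1)] assms(2) p by fastforce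

text \<open>The connecting walks of a core edge weigh at least \<open>\<theta>\<close>, and the
  Hilbert-Schmidt bound permits this only if the out-degree of the head and the in-degree of the
  tail are large enough. By \<open>sL\<close> each factor in between costs at most
  \<open>2 * L * (n * p)^2\<close>.\<close>

lemma degree_product:
  assumes "I \<in> \<I>" "t \<in> I"
  shows "c * (real n * p\<^sup>2 * n) / L ^ (l - 1)
    \<le> (real n * p\<^sup>2 + card {t' \<in> I. slot_src t' = slot_dst l t})
      * (real n * p\<^sup>2 + card {t' \<in> I. slot_dst l t' = slot_src t})"
proof -
  obtain j x y where t: "t = (j, x, y)" by (cases t)
  define q where "q = real n * p"
  define A where "A = real n * p\<^sup>2 + card {t' \<in> I. slot_src t' = slot_dst l t}"
  define B where "B = real n * p\<^sup>2 + card {t' \<in> I. slot_dst l t' = slot_src t}"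
  define k where "k = l - 3"
  have lk: "l = k + 3" using l by (simp add: k_def)
  have q: "1 \<le> q" using q1 by (simp add: q_def)
  have AB: "0 \<le> A" "0 \<le> B" by (auto simp: A_def B_def)
  have hs: "q\<^sup>2 + card I \<le> 2 * L * q\<^sup>2"
  proof -
    have "q\<^sup>2 * 1 \<le> q\<^sup>2 * L" using L1 by (intro mult_left_mono) auto
    then show ?thesis using sL \<I>(2)[OF assms(1)] by (simp add: q_def algebra_simps)
  qed
  have "(\<delta> * q ^ (k + 1) / (4 * L))\<^sup>2 \<le> (mprod n (wt l p I) (Suc j) (l - 1) y x)\<^sup>2"
    using \<theta> connecting_walks_ge[of I j x y] assms t \<delta> q L1
    by (intro power_mono) (auto simp: q_def[symmetric] lk)
  also have "\<dots> \<le> A * (q\<^sup>2 + card I) ^ k * B"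
    using connecting_walks_square_le[of I l n j x y p] \<I>(1) assms l unfolding t A_def B_def q_def k_def by blast
  also have "\<dots> \<le> A * (2 * L * q\<^sup>2) ^ k * B"
    using hs AB by (intro mult_right_mono mult_left_mono power_mono) auto
  finally have "(\<delta> * q ^ (k + 1) / (4 * L))\<^sup>2 \<le> (2 * L * q\<^sup>2) ^ k * (A * B)" by (simp add: mult_ac)
  moreover have "(\<delta> * q ^ (k + 1) / (4 * L))\<^sup>2 = (2 * L * q\<^sup>2) ^ k * (c * q\<^sup>2 / L ^ (l - 1))"
  proof -
    have "c = \<delta>\<^sup>2 / (16 * 2 ^ k)" unfolding c_def by (simp add: lk power_add)
    moreover have "L ^ (l - 1) = L ^ k * L * L" by (simp add: lk power_add)
    ultimately show ?thesis
      using q L1 by (simp add: power_mult_distrib power_divide field_simps power_add power2_eq_square)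
  qed
  moreover have "0 < (2 * L * q\<^sup>2) ^ k" using q L1 by simp
  ultimately have "c * q\<^sup>2 / L ^ (l - 1) \<le> A * B" by (simp only: mult_le_cancel_left_pos)
  moreover have "q\<^sup>2 = real n * p\<^sup>2 * n" by (simp add: q_def power2_eq_square mult_ac)
  ultimately show ?thesis by (simp add: A_def B_def)
qed

text \<open>If neither end is a hub, \<open>hub_dichotomy\<close> disposes of the terms
  \<open>n * p^2\<close> and leaves \<open>Q \<le> u * w\<close>. So \<open>u\<close> and
  \<open>w\<close> are positive, and the edge itself adds 1 to the degree of each end, which gives
  degrees at least 2.\<close>

lemma hub_or_product:
  assumes I: "I \<in> \<I>" and t: "t \<in> I" and small: "4 * L ^ (l - 1) * p\<^sup>2 \<le> c"
  defines "d \<equiv> deg slot_src (slot_dst l) I"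
  shows "H \<le> d (slot_src t) \<or> H \<le> d (slot_dst l t) \<or>
    (Q \<le> real (d (slot_src t)) * d (slot_dst l t) \<and> 2 \<le> d (slot_src t) \<and> 2 \<le> d (slot_dst l t))"
proof (cases "H \<le> d (slot_src t) \<or> H \<le> d (slot_dst l t)")
  case True
  then show ?thesis by blast
next
  case False
  then have nh: "\<not> (H \<le> d (slot_src t))" "\<not> (H \<le> d (slot_dst l t))" by auto
  define u where "u = card {t' \<in> I. slot_src t' = slot_dst l t}"
  define w where "w = card {t' \<in> I. slot_dst l t' = slot_src t}"
  have finI: "finite I" using \<I>(1)[OF I] finite_subset[OF _ finite_slots] by blast
  have "0 < card {t' \<in> I. slot_src t' = slot_src t}" "0 < card {t' \<in> I. slot_dst l t' = slot_dst l t}"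
    using finI t by (simp_all add: card_fibre_pos)
  then have t1: "1 \<le> card {t' \<in> I. slot_src t' = slot_src t}" "1 \<le> card {t' \<in> I. slot_dst l t' = slot_dst l t}"
    by simp_all
  have du: "d (slot_src t) = card {t' \<in> I. slot_src t' = slot_src t} + w"
    "d (slot_dst l t) = u + card {t' \<in> I. slot_dst l t' = slot_dst l t}"
    by (auto simp: d_def deg_def u_def w_def)
  have "c * (real n * p\<^sup>2 * n) / (2 * L ^ (l - 1)) \<le> real u * real w"
  proof (rule hub_dichotomy)
    show "real n * p\<^sup>2 \<le> c * real n / (4 * L ^ (l - 1))"
    proof -
      have "real n * (4 * L ^ (l - 1) * p\<^sup>2) \<le> real n * c" using small by (intro mult_left_mono) auto
      then show ?thesis using Y0 by (simp add: field_simps)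
    qed
    show "real u \<le> c * real n / (8 * L ^ (l - 1))" "real w \<le> c * real n / (8 * L ^ (l - 1))"
      using nh du by (auto simp: H_def)
  qed (use degree_product[OF I t] Y0 c0 in \<open>auto simp: u_def w_def\<close>)
  then have Quw: "Q \<le> real u * real w" by (simp add: Q_def power2_eq_square mult_ac)
  then have "0 < real u * real w" using Q0 by linarith
  then have uw: "1 \<le> u" "1 \<le> w" by (auto simp: zero_less_mult_iff)
  have "real u * real w \<le> d (slot_dst l t) * d (slot_src t)"
    unfolding du of_nat_mult of_nat_add by (intro mult_mono) auto
  then have "Q \<le> real (d (slot_src t)) * d (slot_dst l t)" using Quw by (simp add: mult.commute)
  moreover have "2 \<le> d (slot_src t)" "2 \<le> d (slot_dst l t)" using uw t1 du by simp_all
  ultimately show ?thesis by blast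
qed

text \<open>The 40 is 32 from \<open>4 * n / H\<close> plus 8 from \<open>4 * s / Q\<close>, where
  \<open>sL\<close> accounts for one more factor \<open>L\<close>.\<close>

lemma beta_le: "exp 1 * (4 * real n / H + 4 * real s / Q) \<le> 40 * exp 1 * L ^ l / c"
proof -
  have Ll: "L ^ l = L ^ (l - 1) * L" using l by (metis Suc_diff_1 Suc_le_eq gr0I mult.commute not_numeral_le_zero power_Suc)
  have Y: "L ^ (l - 1) \<le> L ^ l" using L1 by (intro power_increasing) auto
  have "4 * real n / H = 32 * L ^ (l - 1) / c" using n0 c0 by (simp add: H_def)
  also have "\<dots> \<le> 32 * L ^ l / c" using Y c0 by (intro divide_right_mono) auto
  finally have 1: "4 * real n / H \<le> 32 * L ^ l / c" .
  have q0: "0 < (real n * p)\<^sup>2" using q1 n0 p by simp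
  have "4 * real s / Q = 8 * L ^ (l - 1) / c * (real s / (real n * p)\<^sup>2)" by (simp add: Q_def)
  also have "\<dots> \<le> 8 * L ^ (l - 1) / c * L"
    using sL q0 c0 Y0 by (intro mult_left_mono) (auto simp: field_simps)
  also have "\<dots> = 8 * L ^ l / c" by (simp add: Ll)
  finally have "4 * real n / H + 4 * real s / Q \<le> 40 * L ^ l / c" using 1 by (simp add: add_divide_distrib)
  then have "exp 1 * (4 * real n / H + 4 * real s / Q) \<le> exp 1 * (40 * L ^ l / c)" by (intro mult_left_mono) auto
  then show ?thesis by (simp add: mult_ac)
qed

text \<open>The trivial count of \<open>s\<close> named vertices suffices: since
  \<open>s \<ge> \<epsilon> * (n * p)^2\<close>, taking \<open>z\<close> about
  \<open>s / (l * n)\<close> makes a vertex cost at most a constant times \<open>p^(-1/2)\<close>.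
  The exponent is 1 - 1/2 - 1/4 = 1/4, with 1/4 paid for the powers of \<open>L\<close>.\<close>

lemma dense_bound:
  assumes small: "4 * L ^ (l - 1) * p\<^sup>2 \<le> c" and H2: "2 \<le> H"
    and \<epsilon>: "0 < \<epsilon>" "\<epsilon> * (real n * p)\<^sup>2 \<le> s" and dense: "1 \<le> real n * p powr (3 / 2)"
    and big: "(640 * exp 1 * exp 1 * max 1 (l / \<epsilon>) / c) * L ^ l \<le> p powr (- (1 / 4))"
  shows "real (card \<I>) * p ^ s \<le> (p powr (1 / 4)) ^ s"
proof -
  define \<zeta> where "\<zeta> = max 1 (l / \<epsilon>) * p powr (- (1 / 2))"
  define z where "z = min 1 (s / (real l * n))"
  have ln: "0 < real l * n" using l n0 by simp
  have z: "0 < z" "z \<le> 1" using s ln by (auto simp: z_def)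
  have pp: "1 \<le> p powr (- (1 / 2))" using p by (simp add: powr_minus one_le_inverse powr_le1)
  have "1 / z \<le> \<zeta>"
  proof -
    have "real l * n / s \<le> real l * n / (\<epsilon> * (real n * p)\<^sup>2)"
      using \<epsilon> ln s n0 p by (intro divide_left_mono mult_pos_pos) auto
    also have "\<dots> = (l / \<epsilon>) * (1 / (real n * p\<^sup>2))" using n0 by (simp add: power2_eq_square)
    also have "\<dots> \<le> (l / \<epsilon>) * p powr (- (1 / 2))"
    proof (intro mult_left_mono)
      have "p powr (1 / 2) * 1 \<le> p powr (1 / 2) * (real n * p powr (3 / 2))"
        using dense by (intro mult_left_mono) auto
      also have "\<dots> = real n * (p powr (1 / 2) * p powr (3 / 2))" by simp
      also have "p powr (1 / 2) * p powr (3 / 2) = p\<^sup>2" using p by (simp add: powr_add[symmetric])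
      finally have "p powr (1 / 2) \<le> real n * p\<^sup>2" by simp
      then have "1 / (real n * p\<^sup>2) \<le> 1 / p powr (1 / 2)" using p by (intro divide_left_mono) (auto simp: n0)
      then show "1 / (real n * p\<^sup>2) \<le> p powr (- (1 / 2))" by (simp add: powr_minus_divide)
    qed (use \<epsilon> in auto)
    also have "\<dots> \<le> \<zeta>" unfolding \<zeta>_def by (intro mult_right_mono) auto
    finally have 1: "real l * n / s \<le> \<zeta>" .
    have "1 * 1 \<le> max 1 (l / \<epsilon>) * p powr (- (1 / 2))" using pp by (intro mult_mono) auto
    then have "1 \<le> \<zeta>" by (simp add: \<zeta>_def)
    then show ?thesis using 1 by (auto simp: z_def min_def)
  qed
  then have "(1 / z) ^ s \<le> \<zeta> ^ s" using z by (intro power_mono) auto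
  then have \<zeta>: "(1 / z) powr real s \<le> \<zeta> ^ s" using z by (simp add: powr_realpow)
  have zn: "z * (real l * real n) \<le> s"
  proof -
    have "z * (real l * n) \<le> s / (real l * n) * (real l * n)" using ln by (intro mult_right_mono) (auto simp: z_def)
    also have "\<dots> = s" using ln by (metis less_irrefl nonzero_eq_divide_eq)
    finally show ?thesis .
  qed
  have "real (card \<I>) * p ^ s \<le> (4 * \<zeta> * exp 1 * (40 * exp 1 * L ^ l / c) * p) ^ s"
  proof (rule slots_family_bound[OF _ H0 Q0 z s \<I> _ _ \<zeta> zn beta_le])
    fix I assume I: "I \<in> \<I>"
    have fin: "finite I" using \<I>(1)[OF I] finite_subset[OF _ finite_slots] by blast
    have sub: "slot_src ` I \<subseteq> {..<l} \<times> {..<n}" "slot_dst l ` I \<subseteq> {..<l} \<times> {..<n}"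
      using \<I>(1)[OF I] by (auto simp: slots_def slot_src_def slot_dst_def)
    obtain d where "(\<Sum>x\<in>{..<l} \<times> {..<n}. d x) \<le> 2 * card I"
        "card {x \<in> {..<l} \<times> {..<n}. d x \<noteq> 0} \<le> card I"
        "\<forall>t\<in>I. H \<le> real (d (slot_src t)) \<or> H \<le> real (d (slot_dst l t)) \<or>
           Q \<le> real (d (slot_src t)) * real (d (slot_dst l t))"
      by (rule hub_advice[OF fin _ sub H2 hub_or_product[OF I _ small]]) auto
    then show "\<exists>d. (\<Sum>x\<in>{..<l} \<times> {..<n}. d x) \<le> 2 * s \<and>
        real (card {x \<in> {..<l} \<times> {..<n}. d x \<noteq> 0}) \<le> real s \<and>
        (\<forall>t\<in>I. H \<le> real (d (slot_src t)) \<or> H \<le> real (d (slot_dst l t)) \<or>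
           Q \<le> real (d (slot_src t)) * real (d (slot_dst l t)))"
      using \<I>(2)[OF I] by (intro exI[of _ d]) simp
  qed (use l p in auto)
  also have "\<dots> \<le> (p powr (1 / 4)) ^ s"
  proof (rule power_mono)
    have "4 * \<zeta> * exp 1 * (40 * exp 1 * L ^ l / c) * p
        \<le> ((640 * exp 1 * exp 1 * max 1 (l / \<epsilon>) / c) * L ^ l) * (p powr (- (1 / 2)) * p)"
      using c0 L1 p by (simp add: \<zeta>_def mult_ac divide_right_mono mult_left_mono)
    also have "\<dots> \<le> p powr (- (1 / 4)) * (p powr (- (1 / 2)) * p)"
      using big p by (intro mult_right_mono) auto
    also have "\<dots> = p powr (- (1 / 4)) * (p powr (- (1 / 2)) * p powr 1)" using p by simp
    also have "\<dots> = p powr (1 / 4)" by (simp only: powr_add[symmetric]) simp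
    finally show "4 * \<zeta> * exp 1 * (40 * exp 1 * L ^ l / c) * p \<le> p powr (1 / 4)" .
  qed (use c0 L1 p in \<open>auto simp: \<zeta>_def\<close>)
  finally show ?thesis .
qed

text \<open>A vertex now costs \<open>l * n\<close>, which can be as large as
  \<open>l * p^(-3/2)\<close>, so fewer than two thirds of \<open>s\<close> vertices may be named.
  Taking \<open>D = 40\<close> in \<open>hub_advice\<close> gives 1/2 + 2/40 = 11/20, whence the
  thresholds 40 and \<open>40^2 = 1600\<close>. The exponent is 1 - 33/40 - 3/40 = 1/10, where 33/40
  is 3/2 times 11/20.\<close>

lemma middle_bound:
  assumes small: "4 * L ^ (l - 1) * p\<^sup>2 \<le> c" and H40: "40 \<le> H" and Q1600: "1600 \<le> Q"
    and sparse: "real n * p powr (3 / 2) \<le> 1"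
    and big: "(160 * exp 1 * exp 1 * l / c) * L ^ l \<le> p powr (- (3 / 40))"
  shows "real (card \<I>) * p ^ s \<le> (p powr (1 / 10)) ^ s"
proof -
  define \<zeta> where "\<zeta> = l * p powr (- (33 / 40))"
  define z where "z = 1 / (real l * n)"
  have l1: "1 \<le> real l" "1 \<le> real n" using l n0 by auto
  have ln: "1 \<le> real l * n" using l1 mult_mono[of 1 "real l" 1 "real n"] by simp
  have z: "0 < z" "z \<le> 1" using ln by (auto simp: z_def)
  have "1 / z \<le> l * p powr (- (3 / 2))"
  proof -
    have "real n = (real n * p powr (3 / 2)) * p powr (- (3 / 2))"
      using p by (simp add: mult.assoc powr_add[symmetric])
    also have "\<dots> \<le> 1 * p powr (- (3 / 2))" using sparse by (intro mult_right_mono) auto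
    finally show ?thesis by (simp add: z_def mult_left_mono)
  qed
  then have "(1 / z) powr (11 / 20) \<le> (l * p powr (- (3 / 2))) powr (11 / 20)" using z by (intro powr_mono2) auto
  also have "\<dots> = real l powr (11 / 20) * p powr (- (33 / 40))" by (simp add: powr_mult powr_powr)
  also have "\<dots> \<le> \<zeta>"
    using l1 powr_mono[of "11 / 20" 1 "real l"] by (simp add: \<zeta>_def mult_right_mono)
  finally have "((1 / z) powr (11 / 20)) ^ s \<le> \<zeta> ^ s" by (intro power_mono) auto
  then have \<zeta>: "(1 / z) powr (11 / 20 * s) \<le> \<zeta> ^ s" using z by (subst powr_powr[symmetric]) (simp add: powr_realpow)
  have zn: "z * (real l * real n) \<le> s" using ln s by (simp add: z_def)
  have "real (card \<I>) * p ^ s \<le> (4 * \<zeta> * exp 1 * (40 * exp 1 * L ^ l / c) * p) ^ s"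
  proof (rule slots_family_bound[OF _ H0 Q0 z s \<I> _ _ \<zeta> zn beta_le])
    fix I assume I: "I \<in> \<I>"
    have fin: "finite I" using \<I>(1)[OF I] finite_subset[OF _ finite_slots] by blast
    have sub: "slot_src ` I \<subseteq> {..<l} \<times> {..<n}" "slot_dst l ` I \<subseteq> {..<l} \<times> {..<n}"
      using \<I>(1)[OF I] by (auto simp: slots_def slot_src_def slot_dst_def)
    have H2: "2 \<le> H" using H40 by simp
    obtain d where d: "(\<Sum>x\<in>{..<l} \<times> {..<n}. d x) \<le> 2 * card I"
        "\<And>D. 2 \<le> D \<Longrightarrow> D \<le> H \<Longrightarrow> D\<^sup>2 \<le> Q \<Longrightarrow>
          real (card {x \<in> {..<l} \<times> {..<n}. d x \<noteq> 0}) \<le> card I / 2 + 2 * card I / D"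
        "\<forall>t\<in>I. H \<le> real (d (slot_src t)) \<or> H \<le> real (d (slot_dst l t)) \<or>
           Q \<le> real (d (slot_src t)) * real (d (slot_dst l t))"
      by (rule hub_advice[OF fin _ sub H2 hub_or_product[OF I _ small]]) auto
    have "real (card {x \<in> {..<l} \<times> {..<n}. d x \<noteq> 0}) \<le> 11 / 20 * s"
      using d(2)[of 40] H40 Q1600 \<I>(2)[OF I] by simp
    then show "\<exists>d. (\<Sum>x\<in>{..<l} \<times> {..<n}. d x) \<le> 2 * s \<and>
        real (card {x \<in> {..<l} \<times> {..<n}. d x \<noteq> 0}) \<le> 11 / 20 * s \<and>
        (\<forall>t\<in>I. H \<le> real (d (slot_src t)) \<or> H \<le> real (d (slot_dst l t)) \<or>
           Q \<le> real (d (slot_src t)) * real (d (slot_dst l t)))"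
      using d(1,3) \<I>(2)[OF I] by blast
  qed (use l p in auto)
  also have "\<dots> \<le> (p powr (1 / 10)) ^ s"
  proof (rule power_mono)
    have "4 * \<zeta> * exp 1 * (40 * exp 1 * L ^ l / c) * p
        = ((160 * exp 1 * exp 1 * l / c) * L ^ l) * (p powr (- (33 / 40)) * p)"
      by (simp add: \<zeta>_def mult_ac)
    also have "\<dots> \<le> p powr (- (3 / 40)) * (p powr (- (33 / 40)) * p)"
      using big p by (intro mult_right_mono) auto
    also have "\<dots> = p powr (- (3 / 40)) * (p powr (- (33 / 40)) * p powr 1)" using p by simp
    also have "\<dots> = p powr (1 / 10)" by (simp only: powr_add[symmetric]) simp
    finally show "4 * \<zeta> * exp 1 * (40 * exp 1 * L ^ l / c) * p \<le> p powr (1 / 10)" .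
  qed (use c0 L1 p in \<open>auto simp: \<zeta>_def\<close>)
  finally show ?thesis .
qed

text \<open>Degree products below 1600 are of no use, but \<open>n * p\<close> and \<open>s\<close>
  are then at most a constant times \<open>L^l\<close>. Walks that leave the core contribute at most
  1 to \<open>\<theta> \<ge> 3\<close>, so each edge has more than one connecting walk inside the
  core, and branching saves a fraction \<open>g = 3^(-l)\<close> of the vertices. Per edge this
  leaves \<open>p^g\<close>, half of which pays for the powers of \<open>L\<close>.\<close>

lemma sparse_bound:
  fixes C :: real
  assumes Q1600: "Q < 1600" and \<theta>3: "3 \<le> \<theta>"
    and C: "C = max 1 (3200 / c)"
    and pert: "real l * (2 * C * L ^ l) ^ (l - 1) * p \<le> 1"
    and big: "(32 * exp 1 * exp 1 * C * (l * C)) * (L ^ l * L ^ l) \<le> p powr (- (1 / (2 * 3 ^ l)))"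
  shows "real (card \<I>) * p ^ s \<le> (p powr (1 / (2 * 3 ^ l))) ^ s"
proof -
  define g :: real where "g = 1 / 3 ^ l"
  define q where "q = real n * p"
  have g: "0 < g" "g \<le> 1" by (auto simp: g_def)
  have gh: "1 / (2 * 3 ^ l) = g / 2" by (simp add: g_def)
  have C1: "1 \<le> C" by (simp add: C)
  have L1l: "1 \<le> L ^ l" using L1 by simp
  have Y: "L ^ (l - 1) \<le> L ^ l" using L1 by (intro power_increasing) auto
  have q1: "1 \<le> q" using q1 by (simp add: q_def)
  have q2: "q\<^sup>2 \<le> C * L ^ (l - 1)"
  proof -
    have "q\<^sup>2 = 2 * L ^ (l - 1) / c * Q" using c0 L1 by (simp add: Q_def q_def)
    also have "\<dots> \<le> 2 * L ^ (l - 1) / c * 1600" using Q1600 c0 Y0 by (intro mult_left_mono) auto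
    also have "\<dots> = 3200 / c * L ^ (l - 1)" by simp
    also have "\<dots> \<le> C * L ^ (l - 1)" using Y0 by (intro mult_right_mono) (auto simp: C)
    finally show ?thesis .
  qed
  have "q \<le> q\<^sup>2" using q1 by (simp add: power2_eq_square)
  also have "\<dots> \<le> C * L ^ l" using q2 Y C1 by (meson mult_left_mono order_trans zero_le_one)
  finally have qC: "q \<le> C * L ^ l" .
  have sC: "real s \<le> C * L ^ l"
  proof -
    have "real s \<le> q\<^sup>2 * L" using sL by (simp add: q_def)
    also have "\<dots> \<le> C * L ^ (l - 1) * L" using q2 L1 by (intro mult_right_mono) auto
    also have "\<dots> = C * L ^ l" using l by (simp add: power_eq_if)
    finally show ?thesis .
  qed
  define \<zeta> where "\<zeta> = (l * C * L ^ l) * p powr (- (1 - g))"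
  define z where "z = 1 / (real l * n)"
  have l1: "1 \<le> real l" "1 \<le> real n" using l n0 by auto
  have ln: "1 \<le> real l * n" using l1 mult_mono[of 1 "real l" 1 "real n"] by simp
  have z: "0 < z" "z \<le> 1" using ln by (auto simp: z_def)
  have lC: "1 \<le> l * C * L ^ l" 
  proof -
    have "1 * 1 \<le> real l * C" using l1 C1 by (intro mult_mono) auto
    then have "1 * 1 \<le> real l * C * L ^ l" using L1l by (intro mult_mono) auto
    then show ?thesis by simp
  qed
  have "1 / z \<le> (l * C * L ^ l) * p powr (- 1)"
  proof -
    have "real n = q * p powr (- 1)" using p by (simp add: q_def powr_minus)
    also have "\<dots> \<le> C * L ^ l * p powr (- 1)" using qC by (intro mult_right_mono) auto
    finally have "real l * real n \<le> real l * (C * L ^ l * p powr (- 1))" by (intro mult_left_mono) auto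
    then show ?thesis by (simp only: z_def mult.assoc divide_divide_eq_right mult_1)
  qed
  then have "(1 / z) powr (1 - g) \<le> ((l * C * L ^ l) * p powr (- 1)) powr (1 - g)"
    using z g by (intro powr_mono2) auto
  also have "\<dots> = (l * C * L ^ l) powr (1 - g) * p powr (- (1 - g))"
  proof -
    have "(X * p powr (- 1)) powr (1 - g) = X powr (1 - g) * p powr (- (1 - g))" for X
      by (simp only: powr_mult powr_powr mult_minus1)
    then show ?thesis .
  qed
  also have "\<dots> \<le> (l * C * L ^ l) powr 1 * p powr (- (1 - g))"
    using g lC by (intro mult_right_mono powr_mono) auto
  also have "\<dots> = \<zeta>" using lC by (simp add: \<zeta>_def)
  finally have "((1 / z) powr (1 - g)) ^ s \<le> \<zeta> ^ s" by (intro power_mono) auto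
  then have \<zeta>: "(1 / z) powr ((1 - g) * s) \<le> \<zeta> ^ s" using z by (subst powr_powr[symmetric]) (simp add: powr_realpow)
  have zn: "z * (real l * real n) \<le> s" using ln s by (simp add: z_def)
  \<comment> \<open>The choice \<open>H = n\<close>, \<open>Q = 1\<close> admits every edge between
    vertices of nonzero advice; the resulting \<open>4 + 4 * s\<close> is still at most a constant
    times \<open>L^l\<close>.\<close>
  have \<beta>: "exp 1 * (4 * real n / real n + 4 * real s / 1) \<le> exp 1 * (8 * C * L ^ l)"
  proof (intro mult_left_mono)
    have "1 * 1 \<le> C * L ^ l" using C1 L1l by (intro mult_mono) auto
    then show "4 * real n / real n + 4 * real s / 1 \<le> 8 * C * L ^ l" using n0 sC by simp
  qed auto
  have "real (card \<I>) * p ^ s \<le> (4 * \<zeta> * exp 1 * (exp 1 * (8 * C * L ^ l)) * p) ^ s"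
  proof (rule slots_family_bound[OF _ _ _ z s \<I> _ _ \<zeta> zn \<beta>])
    fix I assume I: "I \<in> \<I>"
    have fin: "finite I" using \<I>(1)[OF I] finite_subset[OF _ finite_slots] by blast
    have sub: "slot_src ` I \<subseteq> {..<l} \<times> {..<n}" "slot_dst l ` I \<subseteq> {..<l} \<times> {..<n}"
      using \<I>(1)[OF I] by (auto simp: slots_def slot_src_def slot_dst_def)
    have ne: "I \<noteq> {}" using \<I>(2)[OF I] s by auto
    define d where "d = deg slot_src (slot_dst l) I"
    have "(\<Sum>x\<in>{..<l} \<times> {..<n}. d x) = 2 * s"
      using sum_deg_V[OF fin _ sub] \<I>(2)[OF I] by (simp add: d_def)
    moreover have "real (card {x \<in> {..<l} \<times> {..<n}. d x \<noteq> 0}) \<le> (1 - g) * s"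
      unfolding d_def g_def \<I>(2)[OF I, symmetric]
    proof (rule card_verts_le_of_connecting_walks[OF \<I>(1)[OF I]])
      fix j x y assume t: "(j, x, y) \<in> I"
      then have xy: "y < n" "x < n" using \<I>(1)[OF I] by (auto simp: slots_def)
      have "\<theta> \<le> mprod n (wt l p I) (Suc j) (l - 1) y x" by (rule connecting_walks_ge[OF I t])
      also have "\<dots> \<le> mprod n (wt l 0 I) (Suc j) (l - 1) y x + real (l - 1) * p * (real n * p + card I) ^ (l - 1)"
        using p by (intro connecting_walks_le_count[OF \<I>(1)[OF I] ne _ xy]) auto
      also have "real (l - 1) * p * (real n * p + card I) ^ (l - 1) \<le> real l * p * (2 * C * L ^ l) ^ (l - 1)"
        using qC sC p \<I>(2)[OF I] by (intro mult_mono power_mono) (auto simp: q_def)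
      also have "\<dots> \<le> 1" using pert by (simp add: mult_ac)
      finally show "1 < mprod n (wt l 0 I) (Suc j) (l - 1) y x" using \<theta>3 by linarith
    qed (use l in auto)
    moreover have "1 \<le> real (d (slot_src t)) * real (d (slot_dst l t))" if "t \<in> I" for t
    proof -
      have "0 < card {t' \<in> I. slot_src t' = slot_src t}" "0 < card {t' \<in> I. slot_dst l t' = slot_dst l t}"
        using fin that by (simp_all add: card_fibre_pos)
      then have "0 < d (slot_src t)" "0 < d (slot_dst l t)" by (simp_all add: d_def deg_def)
      then have "1 \<le> d (slot_src t) * d (slot_dst l t)" by simp
      then show ?thesis by (metis of_nat_1 of_nat_le_iff of_nat_mult)
    qed
    ultimately show "\<exists>d. (\<Sum>x\<in>{..<l} \<times> {..<n}. d x) \<le> 2 * s \<and>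
        real (card {x \<in> {..<l} \<times> {..<n}. d x \<noteq> 0}) \<le> (1 - g) * s \<and>
        (\<forall>t\<in>I. real n \<le> real (d (slot_src t)) \<or> real n \<le> real (d (slot_dst l t)) \<or>
           1 \<le> real (d (slot_src t)) * real (d (slot_dst l t)))"
      by (intro exI[of _ d]) auto
  qed (use l p n0 in auto)
  also have "\<dots> \<le> (p powr (g / 2)) ^ s"
  proof (rule power_mono)
    have "4 * \<zeta> * exp 1 * (exp 1 * (8 * C * L ^ l)) * p
        = ((32 * exp 1 * exp 1 * C * (l * C)) * (L ^ l * L ^ l)) * (p powr (- (1 - g)) * p)"
      by (simp add: \<zeta>_def mult_ac)
    also have "\<dots> \<le> p powr (- (g / 2)) * (p powr (- (1 - g)) * p)"
      using big[unfolded gh] p by (intro mult_right_mono) auto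
    also have "\<dots> = p powr (- (g / 2)) * (p powr (- (1 - g)) * p powr 1)" using p by simp
    also have "\<dots> = p powr (g / 2)" by (simp only: powr_add[symmetric]) (simp add: field_simps)
    finally show "4 * \<zeta> * exp 1 * (exp 1 * (8 * C * L ^ l)) * p \<le> p powr (g / 2)" .
  qed (use C1 L1 p in \<open>auto simp: \<zeta>_def\<close>)
  finally show ?thesis unfolding gh .
qed

end

lemma power_le_exp_eventually:
  fixes C a :: real
  assumes "0 < a"
  shows "eventually (\<lambda>L. C * L ^ b \<le> exp (a * L)) at_top"
proof -
  have "filterlim (\<lambda>L. a * L) at_top at_top"
    by (rule filterlim_tendsto_pos_mult_at_top[OF tendsto_const assms filterlim_ident])
  then have "((\<lambda>L. (a * L) ^ b / exp (a * L)) \<longlongrightarrow> 0) at_top"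
    by (rule filterlim_compose[OF tendsto_power_div_exp_0])
  then have "eventually (\<lambda>L. (a * L) ^ b / exp (a * L) < a ^ b / (\<bar>C\<bar> + 1)) at_top"
    using assms by (intro order_tendstoD(2)) auto
  then show ?thesis using eventually_ge_at_top[of 0]
  proof eventually_elim
    case (elim L)
    have "C * L ^ b \<le> (\<bar>C\<bar> + 1) * L ^ b" using elim by (intro mult_right_mono) auto
    also have "\<dots> \<le> exp (a * L)"
    proof -
      have K: "0 < \<bar>C\<bar> + 1" by linarith
      have "(a * L) ^ b * (\<bar>C\<bar> + 1) < a ^ b * exp (a * L)"
        using elim(1) K by (simp add: pos_less_divide_eq) (simp add: field_simps)
      then have "a ^ b * ((\<bar>C\<bar> + 1) * L ^ b) < a ^ b * exp (a * L)"
        by (simp only: power_mult_distrib mult_ac)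
      then show ?thesis using assms by (simp only: mult_less_cancel_left_pos zero_less_power less_imp_le)
    qed
    finally show ?case .
  qed
qed

text \<open>Once \<open>L\<close> is large, every power of \<open>L\<close> lost in a regime is
  below the power of \<open>1/p\<close> reserved for it. The gain is the worst of 1/4, 1/10 and
  \<open>1 / (2 * 3^l)\<close>, which is the last one as \<open>l \<ge> 3\<close>.\<close>

lemma core_families_bound:
  assumes l: "3 \<le> l" and \<delta>: "0 < \<delta>" and \<epsilon>: "0 < \<epsilon>"
  obtains L\<^sub>0 :: real where "1 \<le> L\<^sub>0"
    "\<And>n s p \<theta> \<I>. L\<^sub>0 \<le> ln (1 / p) \<Longrightarrow> core_family l n s p \<delta> \<theta> (ln (1 / p)) \<I> \<Longrightarrow> 3 \<le> \<theta> \<Longrightarrow>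
       \<epsilon> * (real n * p)\<^sup>2 \<le> s \<Longrightarrow> real (card \<I>) * p ^ s \<le> (p powr (1 / (2 * 3 ^ l))) ^ s"
proof -
  define \<gamma> where "\<gamma> = \<delta>\<^sup>2 / 2 ^ (l + 1)"
  define C where "C = max 1 (3200 / \<gamma>)"
  have g0: "0 < \<gamma>" using \<delta> by (simp add: \<gamma>_def)
  \<comment> \<open>After \<open>1 \<le> L\<close> come the conditions for \<open>small\<close> and
    \<open>40 \<le> H\<close>, for the losses in the dense and the middle regime, and for the
    perturbation and the losses in the sparse regime. Each \<open>exp (a * L)\<close> will be read
    as \<open>p powr (- a)\<close>.\<close>
  have "eventually (\<lambda>L. 1 \<le> L
      \<and> (4 / \<gamma>) * L ^ (l - 1) \<le> exp (2 * L) \<and> (320 / \<gamma>) * L ^ (l - 1) \<le> exp (1 * L)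
      \<and> (640 * exp 1 * exp 1 * max 1 (l / \<epsilon>) / \<gamma>) * L ^ l \<le> exp (1 / 4 * L)
      \<and> (160 * exp 1 * exp 1 * l / \<gamma>) * L ^ l \<le> exp (3 / 40 * L)
      \<and> (real l * (2 * C) ^ (l - 1)) * L ^ (l * (l - 1)) \<le> exp (1 * L)
      \<and> (32 * exp 1 * exp 1 * C * (l * C)) * L ^ (l + l) \<le> exp (1 / (2 * 3 ^ l) * L)) at_top"
    by (intro eventually_conj eventually_ge_at_top power_le_exp_eventually) auto
  then obtain L\<^sub>0 where L\<^sub>0: "\<And>L. L\<^sub>0 \<le> L \<Longrightarrow> 1 \<le> L
      \<and> (4 / \<gamma>) * L ^ (l - 1) \<le> exp (2 * L) \<and> (320 / \<gamma>) * L ^ (l - 1) \<le> exp (1 * L)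
      \<and> (640 * exp 1 * exp 1 * max 1 (l / \<epsilon>) / \<gamma>) * L ^ l \<le> exp (1 / 4 * L)
      \<and> (160 * exp 1 * exp 1 * l / \<gamma>) * L ^ l \<le> exp (3 / 40 * L)
      \<and> (real l * (2 * C) ^ (l - 1)) * L ^ (l * (l - 1)) \<le> exp (1 * L)
      \<and> (32 * exp 1 * exp 1 * C * (l * C)) * L ^ (l + l) \<le> exp (1 / (2 * 3 ^ l) * L)"
    unfolding eventually_at_top_linorder by blast
  show ?thesis
  proof (rule that[of L\<^sub>0])
    show "1 \<le> L\<^sub>0" using L\<^sub>0[of L\<^sub>0] by simp
    fix n s :: nat and p \<theta> :: real and \<I>
    define L where "L = ln (1 / p)"
    assume "L\<^sub>0 \<le> ln (1 / p)" and fam: "core_family l n s p \<delta> \<theta> (ln (1 / p)) \<I>"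
      and \<theta>3: "3 \<le> \<theta>" and \<epsilon>s: "\<epsilon> * (real n * p)\<^sup>2 \<le> s"
    then interpret core_family l n s p \<delta> \<theta> L \<I> by (simp add: L_def)
    have cc: "core_family.c l \<delta> = \<gamma>" by (simp add: \<gamma>_def core_family.c_def[OF core_family_axioms])
    have ex: "exp (a * L) = p powr (- a)" for a
      using p by (simp add: L_def powr_def ln_div)
    note ev = L\<^sub>0[OF \<open>L\<^sub>0 \<le> ln (1 / p)\<close>, folded L_def, unfolded ex]
    have small: "4 * L ^ (l - 1) * p\<^sup>2 \<le> \<gamma>"
    proof -
      have "(4 / \<gamma>) * L ^ (l - 1) * p\<^sup>2 \<le> p powr (- 2) * p\<^sup>2"
        using ev by (intro mult_right_mono) auto
      also have "\<dots> = p powr (- 2) * p powr 2" using p by simp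
      also have "\<dots> = 1" using p by (simp only: powr_add[symmetric]) simp
      finally show ?thesis using g0 by (simp add: field_simps)
    qed
    have H40: "40 \<le> H"
    proof -
      have "320 / \<gamma> * L ^ (l - 1) \<le> p powr (- 1)" using ev by blast
      also have "\<dots> = 1 / p" using p by (simp add: powr_minus_divide)
      also have "\<dots> \<le> n" using q1 p by (simp add: field_simps)
      finally show ?thesis using g0 Y0 unfolding H_def cc by (simp add: field_simps)
    qed
    have mono: "(p powr a) ^ s \<le> (p powr (1 / (2 * 3 ^ l))) ^ s" if "1 / 10 \<le> a" for a
    proof (intro power_mono powr_mono')
      have "(3::real) ^ 3 \<le> 3 ^ l" using l by (intro power_increasing) auto
      then have "1 / (2 * 3 ^ l) \<le> (1 / 10 :: real)" by (simp add: field_simps)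
      then show "1 / (2 * 3 ^ l) \<le> a" using that by linarith
    qed (use p in auto)
    show "real (card \<I>) * p ^ s \<le> (p powr (1 / (2 * 3 ^ l))) ^ s"
    proof (cases "1 \<le> real n * p powr (3 / 2)")
      case True
      have "real (card \<I>) * p ^ s \<le> (p powr (1 / 4)) ^ s"
        by (rule dense_bound[OF _ _ \<epsilon> \<epsilon>s True, unfolded cc]) (use small H40 ev in linarith)+
      then show ?thesis using mono[of "1 / 4"] by simp
    next
      case False
      show ?thesis
      proof (cases "1600 \<le> Q")
        case True
        have "real (card \<I>) * p ^ s \<le> (p powr (1 / 10)) ^ s"
          by (rule middle_bound[OF _ H40 True, unfolded cc]) (use small False ev in linarith)+
        then show ?thesis using mono[of "1 / 10"] by simp
      next
        case False
        show ?thesis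
        proof (rule sparse_bound[OF _ \<theta>3])
          show "Q < 1600" using False by simp
          show "C = max 1 (3200 / core_family.c l \<delta>)" by (simp add: cc C_def)
          have "real l * (2 * C * L ^ l) ^ (l - 1) * p = (real l * (2 * C) ^ (l - 1)) * L ^ (l * (l - 1)) * p"
            by (simp only: power_mult_distrib power_mult[symmetric] mult.assoc)
          also have "\<dots> \<le> p powr (- 1) * p" using ev p by (intro mult_right_mono) auto
          also have "\<dots> = 1" using p by (simp add: powr_minus)
          finally show "real l * (2 * C * L ^ l) ^ (l - 1) * p \<le> 1" .
          show "32 * exp 1 * exp 1 * C * (l * C) * (L ^ l * L ^ l) \<le> p powr - (1 / (2 * 3 ^ l))"
            using ev unfolding power_add by blast
        qed
      qed
    qed
  qed
qed

section \<open>From the random graph to sets of slots\<close>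

text \<open>For \<open>l \<ge> 3\<close> no two classes follow each other in both orders. For
  \<open>l = 2\<close> the slots \<open>(0, a, b)\<close> and \<open>(1, b, a)\<close> would be the
  same pair.\<close>

lemma slot_pair_inj:
  assumes "3 \<le> l"
  shows "inj_on (\<lambda>t. {slot_src t, slot_dst l t}) (slots l n)"
proof (rule inj_onI)
  fix t t' assume t: "t \<in> slots l n" "t' \<in> slots l n"
    and eq: "{slot_src t, slot_dst l t} = {slot_src t', slot_dst l t'}"
  obtain i a b where ti: "t = (i, a, b)" by (cases t)
  obtain j a' b' where tj: "t' = (j, a', b')" by (cases t')
  have ij: "i < l" "j < l" using t by (auto simp: slots_def ti tj)
  have "\<not> (i = Suc j mod l \<and> Suc i mod l = j)"
    using ij assms by (auto simp: mod_Suc split: if_splits)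
  then show "t = t'"
    using eq by (auto simp: ti tj slot_src_def slot_dst_def doubleton_eq_iff)
qed

lemma potential_edges_eq: "0 < l \<Longrightarrow> potential_edges l n = (\<lambda>t. {slot_src t, slot_dst l t}) ` slots l n"
proof (intro equalityI subsetI)
  fix e assume "e \<in> potential_edges l n"
  then obtain i a b where "i < l" "a < n" "b < n" "e = {(i, a), (Suc i mod l, b)}"
    by (auto simp: potential_edges_def part_def)
  then show "e \<in> (\<lambda>t. {slot_src t, slot_dst l t}) ` slots l n"
    by (intro image_eqI[where x = "(i, a, b)"]) (auto simp: slots_def slot_src_def slot_dst_def)
next
  fix e assume "e \<in> (\<lambda>t. {slot_src t, slot_dst l t}) ` slots l n"
  then obtain i a b where "i < l" "a < n" "b < n" "e = {(i, a), (Suc i mod l, b)}"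
    by (auto simp: slots_def slot_src_def slot_dst_def)
  then show "e \<in> potential_edges l n"
    unfolding potential_edges_def part_def by blast
qed

text \<open>A copy contains the \<open>l\<close> edges along its transversal, and the isomorphism
  allows at most \<open>l\<close> edges. So it has no others and is determined by its vertices. For
  an upper tail the inequality is enough.\<close>

lemma card_cycle_copies_le:
  assumes l: "3 \<le> l" and E: "E \<subseteq> potential_edges l n"
  shows "card (cycle_copies l n (V, E))
    \<le> card {c \<in> PiE {..<l} (\<lambda>_. {..<n}). cycle_slots l c \<subseteq> {t \<in> slots l n. {slot_src t, slot_dst l t} \<in> E}}"
proof -
  define A where "A = {c \<in> PiE {..<l} (\<lambda>_. {..<n}). cycle_slots l c \<subseteq> {t \<in> slots l n. {slot_src t, slot_dst l t} \<in> E}}"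
  define g where "g c = ((\<lambda>i. (i, c i)) ` {..<l}, (\<lambda>t. {slot_src t, slot_dst l t}) ` cycle_slots l c)"
    for c :: "nat \<Rightarrow> nat"
  have finA: "finite A" by (simp add: A_def finite_PiE)
  have "cycle_copies l n (V, E) \<subseteq> g ` A"
  proof
    fix K assume K: "K \<in> cycle_copies l n (V, E)"
    then obtain v where v: "verts K = v ` {..<l}" "\<And>i. i < l \<Longrightarrow> v i \<in> part n i"
        "\<And>i. i < l \<Longrightarrow> {v i, v (Suc i mod l)} \<in> edges K"
      and sub: "edges K \<subseteq> E" "\<And>e. e \<in> edges K \<Longrightarrow> e \<subseteq> verts K"
      and iso: "graph_isomorphic K (cycle_graph l)"
      by (auto simp: cycle_copies_def is_subgraph_def edges_def)
    define c where "c = (\<lambda>i\<in>{..<l}. snd (v i))"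
    have vi: "v i = (i, c i)" "c i < n" if "i < l" for i
      using v(2)[OF that] that by (auto simp: c_def part_def)
    have l0: "Suc i mod l < l" for i using l by simp
    have cs: "cycle_slots l c \<subseteq> slots l n" using vi l0 by (auto simp: cycle_slots_def slots_def)
    have pair: "(\<lambda>t. {slot_src t, slot_dst l t}) ` cycle_slots l c = (\<lambda>i. {v i, v (Suc i mod l)}) ` {..<l}"
      unfolding cycle_slots_def image_image
      by (rule image_cong) (use vi l0 in \<open>simp_all add: slot_src_def slot_dst_def\<close>)
    have pairE: "(\<lambda>t. {slot_src t, slot_dst l t}) ` cycle_slots l c \<subseteq> edges K"
      unfolding pair using v(3) by auto
    obtain \<phi> where \<phi>: "bij_betw \<phi> (verts K) (verts (cycle_graph l))"
        "\<And>x y. x \<in> verts K \<Longrightarrow> y \<in> verts K \<Longrightarrow> {x, y} \<in> edges K \<longleftrightarrow> {\<phi> x, \<phi> y} \<in> edges (cycle_graph l)"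
      using iso unfolding graph_isomorphic_def by blast
    have "edges K \<subseteq> Pow (verts K)" using sub(2) by blast
    then have "inj_on (image \<phi>) (edges K)"
      using inj_on_image_Pow[OF bij_betw_imp_inj_on[OF \<phi>(1)]] inj_on_subset by blast
    moreover have "image \<phi> ` edges K \<subseteq> edges (cycle_graph l)"
    proof
      fix e' assume "e' \<in> image \<phi> ` edges K"
      then obtain e where e: "e \<in> edges K" "e' = \<phi> ` e" by blast
      then obtain x y where "e = {x, y}" using sub(1) E by (auto simp: potential_edges_def)
      then show "e' \<in> edges (cycle_graph l)" using e sub(2)[of e] \<phi>(2)[of x y] by auto
    qed
    moreover have fine: "finite (edges (cycle_graph l))" by (simp add: cycle_graph_def edges_def)
    ultimately have cardK: "card (edges K) \<le> card (edges (cycle_graph l))" and finK: "finite (edges K)"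
      by (auto intro: card_inj_on_le inj_on_finite)
    have "card (edges K) \<le> card (edges (cycle_graph l))" by (rule cardK)
    also have "\<dots> \<le> l" unfolding cycle_graph_def edges_def
      using card_image_le[of "{..<l}" "\<lambda>i. {i, Suc i mod l}"] by simp
    also have "l = card (cycle_slots l c)"
      unfolding cycle_slots_def by (subst card_image) (auto simp: inj_on_def)
    also have "\<dots> = card ((\<lambda>t. {slot_src t, slot_dst l t}) ` cycle_slots l c)"
      by (rule card_image[symmetric]) (rule inj_on_subset[OF slot_pair_inj[OF l] cs])
    finally have eqE: "(\<lambda>t. {slot_src t, slot_dst l t}) ` cycle_slots l c = edges K"
      using pairE finK by (intro card_seteq)
    have "verts K = (\<lambda>i. (i, c i)) ` {..<l}"
      unfolding v(1) by (rule image_cong) (use vi in auto)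
    then have "K = g c" using eqE by (simp add: g_def verts_def edges_def prod_eq_iff)
    moreover have "c \<in> A"
    proof -
      have "c \<in> PiE {..<l} (\<lambda>_. {..<n})" using vi(2) by (auto simp: c_def)
      moreover have "{slot_src t, slot_dst l t} \<in> E" if "t \<in> cycle_slots l c" for t
        using that pairE sub(1) by blast
      ultimately show ?thesis using cs by (auto simp only: A_def)
    qed
    ultimately show "K \<in> g ` A" by blast
  qed
  then have "card (cycle_copies l n (V, E)) \<le> card A" using finA by (rule surj_card_le[rotated])
  then show ?thesis by (simp only: A_def)
qed

lemma prob_cycle_copies_le:
  assumes l: "3 \<le> l"
  shows "measure_pmf.prob (random_partite_graph l n p) {H. t < real (card (cycle_copies l n H))}
    \<le> measure_pmf.prob (map_pmf (\<lambda>f. {e \<in> slots l n. f e}) (Pi_pmf (slots l n) False (\<lambda>_. bernoulli_pmf p)))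
        {G. t < real (card {c \<in> PiE {..<l} (\<lambda>_. {..<n}). cycle_slots l c \<subseteq> G})}"
proof -
  define P where "P = Pi_pmf (potential_edges l n) False (\<lambda>_. bernoulli_pmf p)"
  \<comment> \<open>The value \<open>{}\<close> is not a potential edge; the transfer along the
    bijection requires \<open>h\<close> to map points outside \<open>slots l n\<close> outside the
    target.\<close>
  define h where "h t = (if t \<in> slots l n then {slot_src t, slot_dst l t} else {})" for t
  have l0: "0 < l" using l by simp
  have "bij_betw h (slots l n) (potential_edges l n)"
    unfolding potential_edges_eq[OF l0] bij_betw_def
    using slot_pair_inj[OF l] by (simp add: h_def cong: inj_on_cong image_cong)
  then have "Pi_pmf (slots l n) False (\<lambda>_. bernoulli_pmf p) = map_pmf (\<lambda>g. g \<circ> h) P"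
    unfolding P_def by (intro Pi_pmf_bij_betw) (auto simp: h_def potential_edges_def)
  then have D: "map_pmf (\<lambda>f. {e \<in> slots l n. f e}) (Pi_pmf (slots l n) False (\<lambda>_. bernoulli_pmf p))
      = map_pmf (\<lambda>f. {e \<in> slots l n. f (h e)}) P"
    by (simp add: map_pmf_comp)
  show ?thesis
    unfolding D random_partite_graph_def P_def[symmetric] measure_map_pmf
  proof (rule measure_pmf.finite_measure_mono)
    show "(\<lambda>f. (partite_verts l n, {e \<in> potential_edges l n. f e})) -` {H. t < real (card (cycle_copies l n H))}
        \<subseteq> (\<lambda>f. {e \<in> slots l n. f (h e)}) -` {G. t < real (card {c \<in> PiE {..<l} (\<lambda>_. {..<n}). cycle_slots l c \<subseteq> G})}"
    proof
      fix f assume f: "f \<in> (\<lambda>f. (partite_verts l n, {e \<in> potential_edges l n. f e})) -` {H. t < real (card (cycle_copies l n H))}"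
      define E where "E = {e \<in> potential_edges l n. f e}"
      have "{t \<in> slots l n. {slot_src t, slot_dst l t} \<in> E} = {e \<in> slots l n. f (h e)}"
        using potential_edges_eq[OF l0, of n] by (auto simp: E_def h_def)
      then have "card (cycle_copies l n (partite_verts l n, E))
          \<le> card {c \<in> PiE {..<l} (\<lambda>_. {..<n}). cycle_slots l c \<subseteq> {e \<in> slots l n. f (h e)}}"
        using card_cycle_copies_le[OF l, of E n "partite_verts l n"] by (simp add: E_def)
      moreover have "t < real (card (cycle_copies l n (partite_verts l n, E)))" using f by (simp add: E_def)
      ultimately show "f \<in> (\<lambda>f. {e \<in> slots l n. f (h e)}) -` {G. t < real (card {c \<in> PiE {..<l} (\<lambda>_. {..<n}). cycle_slots l c \<subseteq> G})}"
        by simp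
    qed
  qed simp
qed

section \<open>The upper tail\<close>

definition cores :: "nat \<Rightarrow> nat \<Rightarrow> real \<Rightarrow> real \<Rightarrow> nat \<Rightarrow> real \<Rightarrow> slot set set" where
  "cores l n p \<delta> m \<theta> = {K \<in> Pow (slots l n). card K \<le> m \<and>
     (1 + \<delta> / 4) * (real n * p) ^ l \<le> expected_cycles l n p K \<and>
     (\<forall>t\<in>K. \<theta> \<le> expected_cycles l n p K - expected_cycles l n p (K - {t}))}"

lemma card_cycle_slots: "card (cycle_slots l c) = l"
  unfolding cycle_slots_def by (subst card_image) (auto simp: inj_on_def)

lemma cycle_slots_subset:
  assumes "0 < l" "c \<in> PiE {..<l} (\<lambda>_. {..<n})"
  shows "cycle_slots l c \<subseteq> slots l n"
  using assms by (auto simp: cycle_slots_def slots_def PiE_def Pi_def)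

lemma cycle_upper_tail_le:
  assumes l: "3 \<le> l" and p: "0 \<le> p" "p \<le> 1" and b: "0 \<le> b" and t: "0 < t" and KK: "KK \<subseteq> Pow (slots l n)"
    and core: "\<And>U. U \<subseteq> slots l n \<Longrightarrow> card U + l \<le> l * k \<Longrightarrow> (\<And>K. K \<in> KK \<Longrightarrow> \<not> K \<subseteq> U) \<Longrightarrow>
                 expected_cycles l n p U \<le> b"
  shows "measure_pmf.prob (random_partite_graph l n p) {H. t < real (card (cycle_copies l n H))}
    \<le> (b / t) ^ k + (\<Sum>K\<in>KK. p ^ card K)"
proof -
  have l0: "0 < l" using l by simp
  let ?D = "map_pmf (\<lambda>f. {e \<in> slots l n. f e}) (Pi_pmf (slots l n) False (\<lambda>_. bernoulli_pmf p))"
  have "measure_pmf.prob ?D {G. t < real (card {c \<in> PiE {..<l} (\<lambda>_. {..<n}). cycle_slots l c \<subseteq> G})}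
      \<le> (b / t) ^ k + (\<Sum>K\<in>KK. p ^ card K)"
  proof (rule upper_tail_le_cores[OF finite_slots])
    show "set_pmf ?D \<subseteq> Pow (slots l n)" by auto
    show "measure_pmf.prob ?D {G. U \<subseteq> G} = p ^ card U" if "U \<subseteq> slots l n" for U
      using prob_random_subset_superset[OF finite_slots p that] .
    show "card (cycle_slots l c) \<le> l" for c by (simp add: card_cycle_slots)
    show "cycle_slots l c \<subseteq> slots l n" if "c \<in> PiE {..<l} (\<lambda>_. {..<n})" for c
      by (rule cycle_slots_subset[OF l0 that])
    show "(\<Sum>c\<in>PiE {..<l} (\<lambda>_. {..<n}). p ^ card (cycle_slots l c - U)) \<le> b"
      if "U \<subseteq> slots l n" "card U + l \<le> l * k" "\<And>K. K \<in> KK \<Longrightarrow> \<not> K \<subseteq> U" for U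
      using core[OF that] by (simp add: expected_cycles_def)
  qed (use assms in \<open>auto simp: finite_PiE\<close>)
  then show ?thesis using prob_cycle_copies_le[OF l, of n p t] by linarith
qed

text \<open>The first moment: for \<open>k = 1\<close> the only set \<open>U\<close> to be tested is
  empty, so no cores are needed. It serves \<open>p = 0\<close> and bounded values of the
  minimum.\<close>

lemma cycle_tail_Markov:
  assumes l: "3 \<le> l" and p: "0 \<le> p" "p \<le> 1" and t: "0 < t"
  shows "measure_pmf.prob (random_partite_graph l n p) {H. t < real (card (cycle_copies l n H))}
    \<le> (real n * p) ^ l / t"
proof -
  have l0: "0 < l" using l by simp
  have "measure_pmf.prob (random_partite_graph l n p) {H. t < real (card (cycle_copies l n H))}
      \<le> ((real n * p) ^ l / t) ^ 1 + (\<Sum>K\<in>({} :: slot set set). p ^ card K)"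
  proof (rule cycle_upper_tail_le[OF l p _ t])
    fix U assume "U \<subseteq> slots l n" "card U + l \<le> l * 1"
    then have "U = {}" using finite_subset[OF _ finite_slots] by auto
    then show "expected_cycles l n p U \<le> (real n * p) ^ l" using expected_cycles_empty[OF l0] by simp
  qed (use p in auto)
  then show ?thesis by simp
qed

text \<open>The share is chosen such that \<open>\<theta> * (l * k) = \<delta> / 4 * \<mu>\<close>:
  passing from \<open>U\<close> to a core gives up at most half of the excess
  \<open>\<delta> / 2 * \<mu>\<close>.\<close>

lemma cycle_tail_le_cores:
  assumes l: "3 \<le> l" and p: "0 < p" "p \<le> 1" and \<delta>: "0 < \<delta>" and n: "0 < n" and k: "0 < k"
  shows "measure_pmf.prob (random_partite_graph l n p)
      {H. (1 + \<delta>) * (real n * p) ^ l < real (card (cycle_copies l n H))}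
    \<le> ((1 + \<delta> / 2) / (1 + \<delta>)) ^ k
      + (\<Sum>K\<in>cores l n p \<delta> (l * k) (\<delta> * (real n * p) ^ l / (4 * (l * k))). p ^ card K)"
proof -
  define \<mu> where "\<mu> = (real n * p) ^ l"
  define \<theta> where "\<theta> = \<delta> * \<mu> / (4 * (l * k))"
  have \<mu>0: "0 < \<mu>" using n p by (simp add: \<mu>_def)
  have lk: "0 < real l * k" using l k by simp
  have \<theta>0: "0 \<le> \<theta>" using \<delta> \<mu>0 by (simp add: \<theta>_def)
  have "measure_pmf.prob (random_partite_graph l n p) {H. (1 + \<delta>) * \<mu> < real (card (cycle_copies l n H))}
    \<le> (((1 + \<delta> / 2) * \<mu>) / ((1 + \<delta>) * \<mu>)) ^ k + (\<Sum>K\<in>cores l n p \<delta> (l * k) \<theta>. p ^ card K)"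
  proof (rule cycle_upper_tail_le[OF l])
    fix U assume U: "U \<subseteq> slots l n" "card U + l \<le> l * k"
      and free: "\<And>K. K \<in> cores l n p \<delta> (l * k) \<theta> \<Longrightarrow> \<not> K \<subseteq> U"
    show "expected_cycles l n p U \<le> (1 + \<delta> / 2) * \<mu>"
    proof (rule ccontr)
      assume seed: "\<not> expected_cycles l n p U \<le> (1 + \<delta> / 2) * \<mu>"
      have finU: "finite U" using U(1) finite_subset[OF _ finite_slots] by blast
      have "card U \<le> l * k" using U(2) by simp
      then obtain K where K: "K \<subseteq> U" "expected_cycles l n p U - \<theta> * real (l * k) \<le> expected_cycles l n p K"
          "\<And>e. e \<in> K \<Longrightarrow> \<theta> \<le> expected_cycles l n p K - expected_cycles l n p (K - {e})"
        using exists_core[OF finU _ \<theta>0, of "l * k" "expected_cycles l n p"] by blast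
      have "\<theta> * real (l * k) = \<delta> / 4 * \<mu>" using l k by (simp add: \<theta>_def)
      then have "(1 + \<delta> / 4) * \<mu> \<le> expected_cycles l n p K"
        using K(2) seed by (simp add: algebra_simps)
      moreover have "card K \<le> l * k" using card_mono[OF finU K(1)] U(2) by simp
      ultimately have "K \<in> cores l n p \<delta> (l * k) \<theta>" using K U(1) by (auto simp: cores_def \<mu>_def)
      then show False using free K(1) by blast
    qed
  qed (use p \<delta> \<mu>0 in \<open>auto simp: cores_def\<close>)
  also have "((1 + \<delta> / 2) * \<mu>) / ((1 + \<delta>) * \<mu>) = (1 + \<delta> / 2) / (1 + \<delta>)" using \<mu>0 by simp
  finally show ?thesis by (simp add: \<mu>_def \<theta>_def)
qed

text \<open>For a smaller set the bound for the squared trace, divided by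
  \<open>(n * p)^(2 * l)\<close>, would give \<open>(1 + \<delta>/4)^2 \<le> (1 + \<epsilon>)^l
  \<le> 1 + \<delta>/4\<close>.\<close>

lemma core_size_gt:
  assumes l: "3 \<le> l" and \<delta>: "0 < \<delta>" and np: "0 < real n * p"
    and \<epsilon>: "0 < \<epsilon>" "(1 + \<epsilon>) ^ l \<le> 1 + \<delta> / 4"
    and K: "K \<in> cores l n p \<delta> m \<theta>"
  shows "\<epsilon> * (real n * p)\<^sup>2 < card K"
proof (rule ccontr)
  define q where "q = real n * p"
  have q: "0 < q" using np by (simp add: q_def)
  have finK: "finite K" using K finite_subset[OF _ finite_slots] by (auto simp: cores_def)
  assume "\<not> \<epsilon> * (real n * p)\<^sup>2 < card K"
  then have le: "q\<^sup>2 + card K \<le> q\<^sup>2 * (1 + \<epsilon>)" by (simp add: q_def algebra_simps)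
  have "((1 + \<delta> / 4) * q ^ l)\<^sup>2 \<le> (expected_cycles l n p K)\<^sup>2"
    using K \<delta> q by (intro power_mono) (auto simp: cores_def q_def)
  also have "\<dots> \<le> (q\<^sup>2 + card K) ^ l"
    using expected_cycles_square_le[OF finK, of l n p] l by (simp add: q_def)
  also have "\<dots> \<le> (q\<^sup>2 * (1 + \<epsilon>)) ^ l" using le q by (intro power_mono) auto
  also have "\<dots> = (q ^ l)\<^sup>2 * (1 + \<epsilon>) ^ l" by (simp add: power_mult_distrib power_mult[symmetric] mult.commute)
  also have "\<dots> \<le> (q ^ l)\<^sup>2 * (1 + \<delta> / 4)" using \<epsilon> by (intro mult_left_mono) auto
  finally have "(q ^ l)\<^sup>2 * (1 + \<delta> / 4)\<^sup>2 \<le> (q ^ l)\<^sup>2 * (1 + \<delta> / 4)" by (simp add: power_mult_distrib mult.commute)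
  then have "(1 + \<delta> / 4)\<^sup>2 \<le> 1 + \<delta> / 4" using q by simp
  then show False using \<delta> by (simp add: power2_eq_square field_simps) (smt (verit) mult_pos_pos)
qed

text \<open>The bound \<open>x^s\<close> is split into two factors \<open>(sqrt x)^s\<close>. One is
  at most \<open>x powr (y / 2)\<close> because \<open>s > y\<close>; the other is at most
  \<open>(1/2)^s\<close> and makes the sum over all sizes converge to at most 1.\<close>

lemma sum_cores_le:
  fixes x y :: real
  assumes p: "0 < p" "p \<le> 1" and x: "0 \<le> x"
    and fam: "\<And>s. 0 < s \<Longrightarrow> real (card {K \<in> KK. card K = s}) * p ^ s \<le> x ^ s"
    and KK: "finite KK" "\<And>K. K \<in> KK \<Longrightarrow> y < card K" "0 \<le> y"
    and x4: "x \<le> 1 / 4"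
  shows "(\<Sum>K\<in>KK. p ^ card K) \<le> x powr (y / 2)"
proof -
  define S where "S = card ` KK"
  define r where "r = sqrt x"
  have r: "0 \<le> r" "r \<le> 1 / 2" "x = r * r" using x x4 real_sqrt_le_mono[OF x4] by (auto simp: r_def real_sqrt_divide)
  have Spos: "y < s" "0 < s" if "s \<in> S" for s using that KK(2,3) by (force simp: S_def)+
  have "(\<Sum>K\<in>KK. p ^ card K) = (\<Sum>s\<in>S. \<Sum>K\<in>{K \<in> KK. card K = s}. p ^ card K)"
    unfolding S_def using KK(1) by (rule sum.image_gen)
  also have "\<dots> = (\<Sum>s\<in>S. real (card {K \<in> KK. card K = s}) * p ^ s)"
    by (intro sum.cong refl) (simp add: sum.cong)
  also have "\<dots> \<le> (\<Sum>s\<in>S. x powr (y / 2) * (1 / 2) ^ s)"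
  proof (rule sum_mono)
    fix s assume s: "s \<in> S"
    have "real (card {K \<in> KK. card K = s}) * p ^ s \<le> x ^ s" using fam Spos(2)[OF s] by simp
    also have "\<dots> = r ^ s * r ^ s" by (simp add: r(3) power_mult_distrib)
    also have "\<dots> \<le> x powr (y / 2) * (1 / 2) ^ s"
    proof (intro mult_mono power_mono)
      show "r ^ s \<le> x powr (y / 2)"
      proof (cases "x = 0")
        case True
        then show ?thesis using Spos(2)[OF s] by (simp add: r_def power_0_left)
      next
        case False
        then have "0 < r" "0 < x" using x by (auto simp: r_def)
        have "r ^ s = r powr s" using \<open>0 < r\<close> by (simp add: powr_realpow)
        also have "\<dots> \<le> r powr y" using Spos(1)[OF s] r \<open>0 < r\<close> by (intro powr_mono') auto
        also have "\<dots> = x powr (y / 2)" using \<open>0 < x\<close> by (simp add: r_def powr_half_sqrt[symmetric] powr_powr)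
        finally show ?thesis .
      qed
    qed (use r in auto)
    finally show "real (card {K \<in> KK. card K = s}) * p ^ s \<le> x powr (y / 2) * (1 / 2) ^ s" .
  qed
  also have "\<dots> = x powr (y / 2) * (\<Sum>s\<in>S. (1 / 2) ^ s)" by (simp add: sum_distrib_left)
  also have "(\<Sum>s\<in>S. (1 / 2 :: real) ^ s) \<le> 1"
  proof -
    have geo: "(\<Sum>s\<in>{1..N}. (1 / 2 :: real) ^ s) = 1 - (1 / 2) ^ N" for N by (induction N) auto
    have "finite S" using KK(1) by (simp add: S_def)
    then have "S \<subseteq> {1..Max S}" using Spos(2) by (auto simp: Suc_le_eq)
    then have "(\<Sum>s\<in>S. (1 / 2 :: real) ^ s) \<le> (\<Sum>s\<in>{1..Max S}. (1 / 2) ^ s)" by (intro sum_mono2) auto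
    also have "\<dots> \<le> 1" unfolding geo by simp
    finally show ?thesis .
  qed
  finally show ?thesis by (simp add: mult_left_mono)
qed

theorem theorem1p3:
  fixes l :: nat and \<delta> :: real
  assumes "l \<ge> 3" and "\<delta> > 0"
  shows "\<exists>c>0. \<forall>n::nat. \<forall>p::real. n > 0 \<longrightarrow> 0 \<le> p \<longrightarrow> p \<le> 1 \<longrightarrow>
    measure_pmf.prob (random_partite_graph l n p)
      {H. real (card (cycle_copies l n H)) > (1 + \<delta>) * real n ^ l * p ^ l}
    < exp (- c * min ((real n)\<^sup>2 * p\<^sup>2 * ln (1 / p)) (real n ^ l * p ^ l))"
proof -
  have l0: "0 < l" using assms(1) by simp
  obtain \<epsilon> :: real where \<epsilon>: "0 < \<epsilon>" "(1 + \<epsilon>) ^ l \<le> 1 + \<delta> / 4"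
  proof -
    have "((\<lambda>e::real. (1 + e) ^ l) \<longlongrightarrow> (1 + 0) ^ l) (at_right 0)" by (intro tendsto_intros)
    then have "eventually (\<lambda>e. (1 + e) ^ l < 1 + \<delta> / 4) (at_right 0)"
      using assms(2) by (intro order_tendstoD(2)) auto
    then have "eventually (\<lambda>e. 0 < e \<and> (1 + e) ^ l < 1 + \<delta> / 4) (at_right 0)"
      by (intro eventually_conj eventually_at_right_less)
    then obtain e :: real where "0 < e" "(1 + e) ^ l < 1 + \<delta> / 4"
      using eventually_happens[of _ "at_right (0::real)"] by auto
    then show ?thesis using that[of e] by simp
  qed
  define g :: real where "g = 1 / (2 * 3 ^ l)"
  have g0: "0 < g" by (simp add: g_def)
  obtain L\<^sub>1 where L\<^sub>1: "1 \<le> L\<^sub>1"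
    "\<And>n s p \<theta> \<I>. L\<^sub>1 \<le> ln (1 / p) \<Longrightarrow> core_family l n s p \<delta> \<theta> (ln (1 / p)) \<I> \<Longrightarrow> 3 \<le> \<theta> \<Longrightarrow>
       \<epsilon> * (real n * p)\<^sup>2 \<le> s \<Longrightarrow> real (card \<I>) * p ^ s \<le> (p powr g) ^ s"
    unfolding g_def using core_families_bound[OF assms \<epsilon>(1)] by metis
  \<comment> \<open>The second term ensures \<open>p powr g \<le> 1 / 4\<close> for
    \<open>L\<^sub>0 \<le> L\<close>, as the sum over core sizes requires.\<close>
  define L\<^sub>0 where "L\<^sub>0 = max L\<^sub>1 (ln 4 / g)"
  have L\<^sub>0: "1 \<le> L\<^sub>0" using L\<^sub>1 by (simp add: L\<^sub>0_def)
  \<comment> \<open>With \<open>m \<le> 2 * l * \<kappa> * M\<close> the three terms ensure, in this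
    order, \<open>m \<le> q^2 * L\<close>, then \<open>3 \<le> \<theta>\<close>, and
    \<open>m \<le> \<epsilon> * q^2\<close> when \<open>L < L\<^sub>0\<close>.\<close>
  define \<kappa> where "\<kappa> = min (1 / (2 * l)) (min (\<delta> / (24 * l)) (\<epsilon> / (2 * l * L\<^sub>0)))"
  have \<kappa>: "0 < \<kappa>" "2 * l * \<kappa> \<le> 1" "24 * l * \<kappa> \<le> \<delta>" "2 * l * L\<^sub>0 * \<kappa> \<le> \<epsilon>"
  proof -
    have lpos: "0 < real l" "0 < real l * L\<^sub>0" using l0 L\<^sub>0 by auto
    show "0 < \<kappa>" using lpos assms(2) \<epsilon> L\<^sub>0 by (simp add: \<kappa>_def)
    have "\<kappa> \<le> 1 / (2 * l)" "\<kappa> \<le> \<delta> / (24 * l)" "\<kappa> \<le> \<epsilon> / (2 * l * L\<^sub>0)" by (simp_all add: \<kappa>_def)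
    then show "2 * l * \<kappa> \<le> 1" "24 * l * \<kappa> \<le> \<delta>" "2 * l * L\<^sub>0 * \<kappa> \<le> \<epsilon>"
      using lpos L\<^sub>0 by (simp_all add: field_simps)
  qed
  define \<rho> where "\<rho> = (1 + \<delta> / 2) / (1 + \<delta>)"
  have \<rho>: "0 < \<rho>" "\<rho> < 1" using assms(2) by (auto simp: \<rho>_def)
  \<comment> \<open>The two terms are the rates of the moment bound \<open>\<rho>^k\<close> and of
    the sum over cores.\<close>
  define a where "a = min (- \<kappa> * ln \<rho>) (\<epsilon> * g / 2)"
  have a0: "0 < a" using \<kappa> \<rho> \<epsilon> g0 by (simp add: a_def mult_pos_neg ln_less_zero)
  \<comment> \<open>From \<open>1 / \<kappa>\<close> on, rounding up to \<open>k\<close> at most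
    doubles \<open>\<kappa> * M\<close>; from \<open>2 / a\<close> on,
    \<open>exp (a * M / 2)\<close> absorbs the factor 2 from adding the two bounds.\<close>
  define K\<^sub>0 where "K\<^sub>0 = max (1 / \<kappa>) (2 / a)"
  have K\<^sub>0: "0 < K\<^sub>0" using \<kappa>(1) by (simp add: K\<^sub>0_def less_max_iff_disj)
  \<comment> \<open>The second term serves \<open>M < K\<^sub>0\<close>, where the Markov bound
    \<open>1 / (1 + \<delta>)\<close> must stay below \<open>exp (- c * M)\<close>.\<close>
  define c where "c = min (a / 2) (ln (1 + \<delta>) / (2 * K\<^sub>0))"
  have c0: "0 < c" using a0 K\<^sub>0 assms(2) by (simp add: c_def)
  have "measure_pmf.prob (random_partite_graph l n p)
      {H. (1 + \<delta>) * real n ^ l * p ^ l < real (card (cycle_copies l n H))}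
    < exp (- c * min ((real n)\<^sup>2 * p\<^sup>2 * ln (1 / p)) (real n ^ l * p ^ l))"
    if n: "0 < n" and p: "0 \<le> p" "p \<le> 1" for n :: nat and p :: real
  proof -
    define L where "L = ln (1 / p)"
    define q where "q = real n * p"
    define M where "M = min (q\<^sup>2 * L) (q ^ l)"
    define P where "P = measure_pmf.prob (random_partite_graph l n p)
      {H. (1 + \<delta>) * q ^ l < real (card (cycle_copies l n H))}"
    have "P < exp (- c * M)"
    proof (cases "M < K\<^sub>0")
      case True
      have "P \<le> 1 / (1 + \<delta>)"
      proof (cases "p = 0")
        case True
        \<comment> \<open>Here the threshold is 0, to which Markov's inequality does not apply; as
          the count is an integer, 1/2 can replace it.\<close>
        have "P \<le> measure_pmf.prob (random_partite_graph l n p) {H. 1 / 2 < real (card (cycle_copies l n H))}"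
        proof -
          have "1 / 2 < real N" if "(1 + \<delta>) * q ^ l < real N" for N :: nat
            using that l0 by (cases N) (simp_all add: q_def True power_0_left)
          then show ?thesis unfolding P_def by (intro measure_pmf.finite_measure_mono) auto
        qed
        also have "\<dots> \<le> (real n * p) ^ l / (1 / 2)" by (rule cycle_tail_Markov[OF assms(1) p]) simp
        also have "\<dots> = 0" using l0 by (simp add: True)
        finally show ?thesis using assms(2) by (simp add: order_trans)
      next
        case False
        then have "0 < q" using p n by (simp add: q_def)
        moreover have "P \<le> q ^ l / ((1 + \<delta>) * q ^ l)"
          unfolding P_def q_def by (rule cycle_tail_Markov[OF assms(1) p]) (use p False n assms(2) in auto)
        ultimately show ?thesis by simp
      qed
      also have "\<dots> = exp (- ln (1 + \<delta>))" using assms(2) by (simp add: exp_minus inverse_eq_divide)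
      also have "\<dots> < exp (- c * M)"
      proof -
        have "c * M < c * K\<^sub>0" using True c0 by simp
        also have "\<dots> \<le> ln (1 + \<delta>) / (2 * K\<^sub>0) * K\<^sub>0" using K\<^sub>0 by (intro mult_right_mono) (auto simp: c_def)
        also have "\<dots> = ln (1 + \<delta>) / 2" using K\<^sub>0 by simp
        also have "\<dots> \<le> ln (1 + \<delta>)" using assms(2) by simp
        finally show ?thesis by simp
      qed
      finally show ?thesis .
    next
      case False
      then have MK: "K\<^sub>0 \<le> M" by simp
      then have M\<kappa>: "1 \<le> \<kappa> * M" and Ma: "2 \<le> a * M"
      proof -
        have "1 / \<kappa> \<le> M" "2 / a \<le> M" using MK by (auto simp: K\<^sub>0_def)
        then show "1 \<le> \<kappa> * M" "2 \<le> a * M" using \<kappa>(1) a0 by (auto simp: field_simps)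
      qed
      have M0: "0 < M" using K\<^sub>0 MK by linarith
      have p0: "0 < p"
      proof (rule ccontr)
        assume "\<not> 0 < p"
        then have "M \<le> 0" using p l0 by (simp add: M_def q_def)
        then show False using M0 by simp
      qed
      have q0: "0 < q" using n p0 by (simp add: q_def)
      have Mq: "M \<le> q\<^sup>2 * L" "M \<le> q ^ l" by (auto simp: M_def)
      define k where "k = nat \<lceil>\<kappa> * M\<rceil>"
      have k: "\<kappa> * M \<le> k" "real k \<le> 2 * (\<kappa> * M)" "0 < k"
        using M\<kappa> by (auto simp: k_def) linarith+
      define m where "m = l * k"
      define \<theta> where "\<theta> = \<delta> * q ^ l / (4 * m)"
      define KK where "KK = cores l n p \<delta> m \<theta>"
      have m: "real m \<le> 2 * l * \<kappa> * M" "0 < m"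
        using mult_left_mono[OF k(2), of "real l"] k(3) l0 by (auto simp: m_def mult_ac)
      have fin: "finite KK" unfolding KK_def cores_def by (rule finite_subset[of _ "Pow (slots l n)"]) auto
      have big: "\<epsilon> * q\<^sup>2 < card K" if "K \<in> KK" for K
        using core_size_gt[OF assms _ \<epsilon>, of n p K m \<theta>] that q0 by (simp add: q_def KK_def)
      have "P \<le> \<rho> ^ k + (\<Sum>K\<in>KK. p ^ card K)"
        using cycle_tail_le_cores[OF assms(1) p0 p(2) assms(2) n k(3)]
        by (simp add: P_def q_def KK_def \<theta>_def m_def \<rho>_def)
      also have "\<rho> ^ k \<le> exp (- a * M)"
      proof -
        have "\<rho> ^ k = exp (k * ln \<rho>)" using \<rho> by (simp add: exp_of_nat_mult)
        also have "k * ln \<rho> \<le> (\<kappa> * M) * ln \<rho>" using k(1) \<rho> by (intro mult_right_mono_neg) (auto simp: ln_le_zero_iff)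
        also have "(\<kappa> * M) * ln \<rho> = - ((- \<kappa> * ln \<rho>) * M)" by simp
        also have "\<dots> \<le> - (a * M)" using M0 by (intro le_imp_neg_le mult_right_mono) (auto simp: a_def)
        finally show ?thesis by simp
      qed
      also have "(\<Sum>K\<in>KK. p ^ card K) \<le> exp (- a * M)"
      proof (cases "L\<^sub>0 \<le> L")
        case True
        have L1: "1 \<le> L" "L\<^sub>1 \<le> L" "ln 4 / g \<le> L" using True L\<^sub>0 by (auto simp: L\<^sub>0_def)
        have pL: "p powr b = exp (- (b * L))" for b using p0 by (simp add: L_def powr_def ln_div)
        have q1: "1 \<le> q"
        proof (rule ccontr)
          assume "\<not> 1 \<le> q"
          then have "q ^ l < 1" using power_strict_mono[of q 1 l] q0 l0 by simp
          moreover have "1 * \<kappa> \<le> 2 * real l * \<kappa>" using \<kappa>(1) l0 by (intro mult_right_mono) auto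
          then have "\<kappa> \<le> 1" using \<kappa>(2) by simp
          then have "\<kappa> * M \<le> 1 * M" using M0 by (intro mult_right_mono) auto
          ultimately show False using M\<kappa> Mq(2) by simp
        qed
        have mL: "real m \<le> q\<^sup>2 * L"
        proof -
          have "real m \<le> (2 * l * \<kappa>) * M" by (rule m(1))
          also have "\<dots> \<le> 1 * M" using \<kappa>(2) M0 by (intro mult_right_mono) auto
          finally show ?thesis using Mq by simp
        qed
        have \<theta>3: "3 \<le> \<theta>"
        proof -
          have "12 * real m \<le> 12 * ((2 * l * \<kappa>) * M)" by (intro mult_left_mono m(1)) simp
          also have "\<dots> = (24 * l * \<kappa>) * M" by simp
          also have "\<dots> \<le> \<delta> * q ^ l" using \<kappa> Mq M0 assms(2) by (intro mult_mono) auto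
          finally show ?thesis using m(2) by (simp add: \<theta>_def field_simps)
        qed
        have \<theta>L: "\<delta> * q ^ (l - 2) / (4 * L) \<le> \<theta>"
        proof -
          have "q ^ l = q ^ (l - 2) * q\<^sup>2" 
            unfolding power_add[symmetric] using assms(1) by (intro arg_cong[of _ _ "power q"]) linarith
          moreover have "\<delta> * q ^ (l - 2) * real m \<le> \<delta> * q ^ (l - 2) * (q\<^sup>2 * L)"
            using mL assms(2) q0 by (intro mult_left_mono) auto
          ultimately show ?thesis using m(2) L1 by (simp add: \<theta>_def field_simps)
        qed
        have "(\<Sum>K\<in>KK. p ^ card K) \<le> (p powr g) powr (\<epsilon> * q\<^sup>2 / 2)"
        proof (rule sum_cores_le[OF p0 p(2) _ _ fin big])
          fix s :: nat assume s: "0 < s"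
          show "real (card {K \<in> KK. card K = s}) * p ^ s \<le> (p powr g) ^ s"
          proof (cases "{K \<in> KK. card K = s} = {}")
            case False
            then obtain K where K: "K \<in> KK" "card K = s" by blast
            have "s \<le> m" using K by (auto simp: KK_def cores_def)
            then have "core_family l n s p \<delta> \<theta> L {K \<in> KK. card K = s}"
              using assms p0 p q1 s L1 mL \<theta>L
              by unfold_locales (auto simp: KK_def cores_def q_def)
            then show ?thesis
              using L\<^sub>1(2)[of p n s \<theta>] L1 \<theta>3 big[OF K(1)] K(2) by (simp add: L_def q_def)
          next
            case True
            show ?thesis unfolding True by simp
          qed
        next
          have "ln 4 \<le> g * L" using L1(3) g0 by (simp add: field_simps)
          then have "exp (- (g * L)) \<le> exp (- ln 4)" by simp
          then show "p powr g \<le> 1 / 4" by (simp add: pL exp_minus)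
        qed (use \<epsilon> in auto)
        also have "\<dots> = exp (- ((\<epsilon> * g / 2) * (q\<^sup>2 * L)))" by (simp only: powr_powr) (simp add: pL mult_ac)
        also have "\<dots> \<le> exp (- a * M)"
        proof -
          have "a * M \<le> (\<epsilon> * g / 2) * (q\<^sup>2 * L)"
            using Mq M0 \<epsilon> g0 by (intro mult_mono) (auto simp: a_def)
          then show ?thesis by simp
        qed
        finally show ?thesis .
      next
        case False
        \<comment> \<open>For bounded \<open>L\<close> a core would have more than
          \<open>\<epsilon> * q^2\<close> but at most \<open>m \<le> \<epsilon> * q^2\<close> edges,
          so the moment bound stands alone.\<close>
        have "K \<notin> KK" for K
        proof
          assume K: "K \<in> KK"
          have "real (card K) \<le> m" using K by (simp add: KK_def cores_def)
          also have "\<dots> \<le> (2 * l * \<kappa>) * M" by (rule m(1))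
          also have "\<dots> \<le> (2 * l * \<kappa>) * (q\<^sup>2 * L\<^sub>0)"
          proof (intro mult_left_mono)
            have "q\<^sup>2 * L \<le> q\<^sup>2 * L\<^sub>0" using False by (intro mult_left_mono) auto
            then show "M \<le> q\<^sup>2 * L\<^sub>0" using Mq by simp
          qed (use \<kappa> in auto)
          also have "\<dots> = (2 * l * L\<^sub>0 * \<kappa>) * q\<^sup>2" by simp
          also have "\<dots> \<le> \<epsilon> * q\<^sup>2" using \<kappa> by (intro mult_right_mono) auto
          finally show False using big[OF K] by simp
        qed
        then have "KK = {}" by blast
        then show ?thesis by simp
      qed
      finally have "P \<le> 2 * exp (- a * M)" by simp
      also have "\<dots> < exp (a * M / 2) * exp (- a * M)"
      proof -
        have "(2::real) < exp 1" using exp_lower_Taylor_quadratic[of "1::real"] by simp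
        also have "exp 1 \<le> exp (a * M / 2)" using Ma by simp
        finally show ?thesis by simp
      qed
      also have "\<dots> = exp (- (a / 2) * M)" by (simp add: exp_add[symmetric])
      also have "\<dots> \<le> exp (- c * M)"
      proof -
        have "c * M \<le> (a / 2) * M" using M0 by (intro mult_right_mono) (auto simp: c_def)
        then show ?thesis by simp
      qed
      finally show ?thesis .
    qed
    then show ?thesis by (simp add: P_def M_def q_def L_def power_mult_distrib mult.assoc)
  qed
  then show ?thesis using c0 by blast
qed

end
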